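(* For every even integer $L\ge 6$, the snowflake graph $X_L$ is neither shortcut nor strongly shortcut.
   Context: For an even integer $L\ge 6$, $$G_L:=\langle a,x,y,s,t\mid sas^{-1}=x,\ tat^{-1}=y,\ a^L=xy,\ [a,x]=[x,y]=[y,a]=1\rangle .$$ The snowflake graph $X_L$ is the Cayley graph of $G_L$ with respect to $\{a,x,y,s,t\}$, metrized as a path metric graph in which $a$-, $s$- and $t$-edges have length $1$ and $x$- and $y$-edges have length $L$. The induced metric on vertices is the word metric of $G_L$ with respect to $\{a,s,t\}$. A cycle in a graph $\Gamma$ is a combinatorial map $\gamma\colon S\to\Gamma$ from a circle $S$ subdivided into edges; $S$ carries the length metric $d_S$ in which each edge has the length of its image, and $|\gamma|=|S|$. For $K\ge1$ it is $K$-biLipschitz if $\frac1K d_S(p,q)\le d_\Gamma(\gamma(p),\gamma(q))\le d_S(p,q)$ for all $p,q\in S$ (so a $1$-biLipschitz cycle is an isometrically embedded cycle). A graph is shortcut if there is a bound on the lengths of its isometrically embedded cycles. A graph is strongly shortcut if, for some $K>1$, there is a bound on the lengths of its $K$-biLipschitz cycles. *)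

theory Defs
  imports Complex_Main "HOL-Algebra.Group" "Graph_Theory.Digraph"
begin

text \<open>A word is a list of letters; \<open>(g, True)\<close> stands for \<open>g\<close> and \<open>(g, False)\<close> for its inverse.
  A relation \<open>l = r\<close> is the pair \<open>(l, r)\<close>.\<close>

type_synonym 'g word = "('g \<times> bool) list"

inductive word_eq :: "('g word \<times> 'g word) set \<Rightarrow> 'g word \<Rightarrow> 'g word \<Rightarrow> bool"
  for R :: "('g word \<times> 'g word) set" where
  refl: "word_eq R u u"
| sym: "word_eq R u v \<Longrightarrow> word_eq R v u"
| trans: "word_eq R u v \<Longrightarrow> word_eq R v w \<Longrightarrow> word_eq R u w"
| cancel: "word_eq R (u @ [(g, b), (g, \<not> b)] @ v) (u @ v)"
| relation: "(l, r) \<in> R \<Longrightarrow> word_eq R (u @ l @ v) (u @ r @ v)"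

definition word_rel :: "('g word \<times> 'g word) set \<Rightarrow> ('g word \<times> 'g word) set" where
  "word_rel R = {(u, v). word_eq R u v}"

definition word_class :: "('g word \<times> 'g word) set \<Rightarrow> 'g word \<Rightarrow> 'g word set" where
  "word_class R u = word_rel R `` {u}"

definition presented_group :: "('g word \<times> 'g word) set \<Rightarrow> 'g word set monoid" where
  "presented_group R = \<lparr>
     carrier = UNIV // word_rel R,
     mult = (\<lambda>U V. \<Union>u\<in>U. \<Union>v\<in>V. word_class R (u @ v)),
     one = word_class R []\<rparr>"

lemma word_eq_context: "word_eq R u v \<Longrightarrow> word_eq R (p @ u @ q) (p @ v @ q)"
proof (induction rule: word_eq.induct)
  case (cancel u g b v)
  show ?case using word_eq.cancel[of R "p @ u" g b "v @ q"] by simp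
next
  case (relation l r u v)
  show ?case using word_eq.relation[OF relation, of "p @ u" "v @ q"] by simp
qed (auto intro: word_eq.intros)

lemma word_eq_append:
  assumes "word_eq R u u'" "word_eq R v v'"
  shows "word_eq R (u @ v) (u' @ v')"
  using word_eq_context[OF assms(1), of "[]" v] word_eq_context[OF assms(2), of u' "[]"]
  by (auto intro: word_eq.trans)

lemma equiv_word_rel: "equiv UNIV (word_rel R)"
  by (rule equivI)
    (auto simp: word_rel_def refl_on_def sym_def trans_def intro: word_eq.intros)

lemma word_class_eq_iff: "word_class R u = word_class R v \<longleftrightarrow> word_eq R u v"
  unfolding word_class_def using eq_equiv_class_iff[OF equiv_word_rel, of u v R]
  by (simp add: word_rel_def)

lemma carrier_presented_group: "carrier (presented_group R) = range (word_class R)"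
  by (auto simp: presented_group_def quotient_def word_class_def)

lemma mult_word_class:
  "word_class R u \<otimes>\<^bsub>presented_group R\<^esub> word_class R v = word_class R (u @ v)"
proof -
  let ?U = "word_class R u" and ?V = "word_class R v"
  have eq: "word_class R (u' @ v') = word_class R (u @ v)" if "u' \<in> ?U" "v' \<in> ?V" for u' v'
  proof -
    have "word_eq R u u'" "word_eq R v v'"
      using that by (simp_all add: word_class_def word_rel_def)
    then show ?thesis
      unfolding word_class_eq_iff by (rule word_eq.sym[OF word_eq_append])
  qed
  have nonempty: "u \<in> ?U" "v \<in> ?V"
    by (simp_all add: word_class_def word_rel_def word_eq.refl)
  have "(\<Union>u'\<in>?U. \<Union>v'\<in>?V. word_class R (u' @ v')) = (\<Union>u'\<in>?U. \<Union>v'\<in>?V. word_class R (u @ v))"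
    by (intro SUP_cong eq HOL.refl)
  also have "\<dots> = word_class R (u @ v)"
    using nonempty by blast
  finally show ?thesis by (simp add: presented_group_def)
qed

lemma word_eq_inverse:
  "word_eq R (rev (map (\<lambda>(g, b). (g, \<not> b)) u) @ u) []"
proof (induction u)
  case (Cons l u)
  obtain g b where "l = (g, b)" by (cases l)
  then show ?case
    using word_eq.cancel[of R "rev (map (\<lambda>(g, b). (g, \<not> b)) u)" g "\<not> b" u] Cons.IH
    by (auto intro: word_eq.trans)
qed (simp add: word_eq.refl)

lemma group_presented_group: "group (presented_group R)"
proof (rule groupI)
  have one: "\<one>\<^bsub>presented_group R\<^esub> = word_class R []"
    by (simp add: presented_group_def)
  show "\<one>\<^bsub>presented_group R\<^esub> \<in> carrier (presented_group R)"
    by (auto simp: one carrier_presented_group)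
  show "\<one>\<^bsub>presented_group R\<^esub> \<otimes>\<^bsub>presented_group R\<^esub> x = x"
    if "x \<in> carrier (presented_group R)" for x
    using that by (auto simp: one carrier_presented_group mult_word_class)
  show "\<exists>y\<in>carrier (presented_group R). y \<otimes>\<^bsub>presented_group R\<^esub> x = \<one>\<^bsub>presented_group R\<^esub>"
    if "x \<in> carrier (presented_group R)" for x
  proof -
    obtain u where "x = word_class R u" using \<open>x \<in> _\<close> unfolding carrier_presented_group by blast
    then show ?thesis using word_eq_inverse[of R u]
      by (auto simp: one carrier_presented_group mult_word_class word_class_eq_iff)
  qed
qed (auto simp: carrier_presented_group mult_word_class)

text \<open>A metric graph is a multigraph (loops allowed) whose edges have lengths. The direction of an
  arc serves only to parametrize the edge; distances and combinatorial maps ignore it.\<close>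

record ('v, 'e) metric_graph = "('v, 'e) pre_digraph" +
  len :: "'e \<Rightarrow> real"

text \<open>Points of the geometric realization: \<open>Inner e u\<close> is the point in the interior of \<open>e\<close> at
  distance \<open>u\<close> from the tail along \<open>e\<close>.\<close>

datatype ('v, 'e) point = Vertex 'v | Inner 'e real

definition points :: "('v, 'e, 'm) metric_graph_scheme \<Rightarrow> ('v, 'e) point set" where
  "points \<Gamma> = Vertex ` verts \<Gamma> \<union> {Inner e u | e u. e \<in> arcs \<Gamma> \<and> 0 < u \<and> u < len \<Gamma> e}"

definition edge_point :: "('v, 'e, 'm) metric_graph_scheme \<Rightarrow> 'e \<Rightarrow> real \<Rightarrow> ('v, 'e) point" where
  "edge_point \<Gamma> e u =
     (if u = 0 then Vertex (tail \<Gamma> e) else if u = len \<Gamma> e then Vertex (head \<Gamma> e) else Inner e u)"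

text \<open>\<open>has_path \<Gamma> p r q\<close>: some piecewise linear path of length \<open>r\<close> goes from \<open>p\<close> to \<open>q\<close>. Each
  piece is a segment in one closed edge. The path metric is the infimum of these lengths; an edge
  need not be a geodesic. The infimum is meaningful only for connected graphs.\<close>

inductive has_path ::
  "('v, 'e, 'm) metric_graph_scheme \<Rightarrow> ('v, 'e) point \<Rightarrow> real \<Rightarrow> ('v, 'e) point \<Rightarrow> bool"
  for \<Gamma> :: "('v, 'e, 'm) metric_graph_scheme" where
  const: "p \<in> points \<Gamma> \<Longrightarrow> has_path \<Gamma> p 0 p"
| segment: "has_path \<Gamma> p r (edge_point \<Gamma> e u) \<Longrightarrow> e \<in> arcs \<Gamma> \<Longrightarrow>
    u \<in> {0..len \<Gamma> e} \<Longrightarrow> v \<in> {0..len \<Gamma> e} \<Longrightarrow> has_path \<Gamma> p (r + \<bar>u - v\<bar>) (edge_point \<Gamma> e v)"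

definition path_dist ::
  "('v, 'e, 'm) metric_graph_scheme \<Rightarrow> ('v, 'e) point \<Rightarrow> ('v, 'e) point \<Rightarrow> real" where
  "path_dist \<Gamma> p q = Inf {r. has_path \<Gamma> p r q}"

text \<open>A combinatorial map sends vertices to vertices and each edge homeomorphically onto an edge;
  \<open>keeps e\<close> tells whether the chosen direction of \<open>e\<close> is preserved or reversed.\<close>

record ('v, 'e, 'v2, 'e2) graph_map =
  vmap :: "'v \<Rightarrow> 'v2"
  emap :: "'e \<Rightarrow> 'e2"
  keeps :: "'e \<Rightarrow> bool"

definition combinatorial_map ::
  "('v, 'e, 'm) metric_graph_scheme \<Rightarrow> ('v2, 'e2, 'n) metric_graph_scheme \<Rightarrow>
   ('v, 'e, 'v2, 'e2) graph_map \<Rightarrow> bool" where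
  "combinatorial_map S \<Gamma> \<gamma> \<longleftrightarrow>
     (\<forall>v\<in>verts S. vmap \<gamma> v \<in> verts \<Gamma>) \<and>
     (\<forall>e\<in>arcs S. emap \<gamma> e \<in> arcs \<Gamma> \<and>
        (if keeps \<gamma> e
         then tail \<Gamma> (emap \<gamma> e) = vmap \<gamma> (tail S e) \<and> head \<Gamma> (emap \<gamma> e) = vmap \<gamma> (head S e)
         else tail \<Gamma> (emap \<gamma> e) = vmap \<gamma> (head S e) \<and> head \<Gamma> (emap \<gamma> e) = vmap \<gamma> (tail S e)))"

text \<open>The induced map on points, for edges mapped to edges of the same length.\<close>

fun point_map ::
  "('v2, 'e2, 'n) metric_graph_scheme \<Rightarrow> ('v, 'e, 'v2, 'e2) graph_map \<Rightarrow>
   ('v, 'e) point \<Rightarrow> ('v2, 'e2) point" where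
  "point_map \<Gamma> \<gamma> (Vertex v) = Vertex (vmap \<gamma> v)"
| "point_map \<Gamma> \<gamma> (Inner e u) =
     Inner (emap \<gamma> e) (if keeps \<gamma> e then u else len \<Gamma> (emap \<gamma> e) - u)"

text \<open>The circle subdivided into \<open>n\<close> edges of lengths \<open>l 0, \<dots>, l (n - 1)\<close>. Its path metric is
  the arc length metric. For \<open>n = 1\<close> it is a loop, for \<open>n = 2\<close> a pair of parallel edges.\<close>

definition circle :: "nat \<Rightarrow> (nat \<Rightarrow> real) \<Rightarrow> (nat, nat) metric_graph" where
  "circle n l = \<lparr>verts = {..<n}, arcs = {..<n}, tail = (\<lambda>i. i), head = (\<lambda>i. Suc i mod n), len = l\<rparr>"

text \<open>A cycle is a pair \<open>(n, \<gamma>)\<close> of a number of edges and a map on the circle with \<open>n\<close> edges.\<close>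

type_synonym ('v, 'e) cycle = "nat \<times> (nat, nat, 'v, 'e) graph_map"

definition cycle_domain ::
  "('v, 'e, 'm) metric_graph_scheme \<Rightarrow> ('v, 'e) cycle \<Rightarrow> (nat, nat) metric_graph" where
  "cycle_domain \<Gamma> c = circle (fst c) (\<lambda>i. len \<Gamma> (emap (snd c) i))"

definition is_cycle :: "('v, 'e, 'm) metric_graph_scheme \<Rightarrow> ('v, 'e) cycle \<Rightarrow> bool" where
  "is_cycle \<Gamma> c \<longleftrightarrow> fst c \<ge> 1 \<and> combinatorial_map (cycle_domain \<Gamma> c) \<Gamma> (snd c)"

definition cycle_length :: "('v, 'e, 'm) metric_graph_scheme \<Rightarrow> ('v, 'e) cycle \<Rightarrow> real" where
  "cycle_length \<Gamma> c = (\<Sum>e\<in>arcs (cycle_domain \<Gamma> c). len (cycle_domain \<Gamma> c) e)"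

definition bilipschitz_cycle ::
  "('v, 'e, 'm) metric_graph_scheme \<Rightarrow> real \<Rightarrow> ('v, 'e) cycle \<Rightarrow> bool" where
  "bilipschitz_cycle \<Gamma> K c \<longleftrightarrow> is_cycle \<Gamma> c \<and>
     (\<forall>p\<in>points (cycle_domain \<Gamma> c). \<forall>q\<in>points (cycle_domain \<Gamma> c).
        1 / K * path_dist (cycle_domain \<Gamma> c) p q
          \<le> path_dist \<Gamma> (point_map \<Gamma> (snd c) p) (point_map \<Gamma> (snd c) q) \<and>
        path_dist \<Gamma> (point_map \<Gamma> (snd c) p) (point_map \<Gamma> (snd c) q)
          \<le> path_dist (cycle_domain \<Gamma> c) p q)"

definition isometric_cycle :: "('v, 'e, 'm) metric_graph_scheme \<Rightarrow> ('v, 'e) cycle \<Rightarrow> bool" where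
  "isometric_cycle \<Gamma> c \<longleftrightarrow> is_cycle \<Gamma> c \<and>
     (\<forall>p\<in>points (cycle_domain \<Gamma> c). \<forall>q\<in>points (cycle_domain \<Gamma> c).
        path_dist \<Gamma> (point_map \<Gamma> (snd c) p) (point_map \<Gamma> (snd c) q)
          = path_dist (cycle_domain \<Gamma> c) p q)"

lemma bilipschitz_one_iff_isometric: "bilipschitz_cycle \<Gamma> 1 c \<longleftrightarrow> isometric_cycle \<Gamma> c"
  by (auto simp: bilipschitz_cycle_def isometric_cycle_def intro: order.antisym)

definition shortcut :: "('v, 'e, 'm) metric_graph_scheme \<Rightarrow> bool" where
  "shortcut \<Gamma> \<longleftrightarrow> (\<exists>B. \<forall>c. isometric_cycle \<Gamma> c \<longrightarrow> cycle_length \<Gamma> c \<le> B)"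

definition strongly_shortcut :: "('v, 'e, 'm) metric_graph_scheme \<Rightarrow> bool" where
  "strongly_shortcut \<Gamma> \<longleftrightarrow>
     (\<exists>K>1. \<exists>B. \<forall>c. bilipschitz_cycle \<Gamma> K c \<longrightarrow> cycle_length \<Gamma> c \<le> B)"

text \<open>The Cayley graph has one edge from \<open>g\<close> to \<open>g\<sigma>\<close> for each group element \<open>g\<close> and each
  generator \<open>\<sigma>\<close>; \<open>l \<sigma>\<close> is the length of the \<open>\<sigma>\<close>-edges.\<close>

definition cayley_graph ::
  "('g, 'm) monoid_scheme \<Rightarrow> ('s \<Rightarrow> 'g) \<Rightarrow> ('s \<Rightarrow> real) \<Rightarrow> ('g, 'g \<times> 's) metric_graph" where
  "cayley_graph G gen l = \<lparr>
     verts = carrier G,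
     arcs = carrier G \<times> UNIV,
     tail = fst,
     head = (\<lambda>(g, \<sigma>). g \<otimes>\<^bsub>G\<^esub> gen \<sigma>),
     len = (\<lambda>(g, \<sigma>). l \<sigma>)\<rparr>"

datatype snowflake_gen = Ga | Gx | Gy | Gs | Gt

abbreviation pos :: "'g \<Rightarrow> 'g \<times> bool" where "pos g \<equiv> (g, True)"
abbreviation neg :: "'g \<Rightarrow> 'g \<times> bool" where "neg g \<equiv> (g, False)"

abbreviation commutator :: "'g \<Rightarrow> 'g \<Rightarrow> 'g word" where
  "commutator g h \<equiv> [pos g, pos h, neg g, neg h]"

definition snowflake_relations :: "nat \<Rightarrow> (snowflake_gen word \<times> snowflake_gen word) set" where
  "snowflake_relations L =
     {([pos Gs, pos Ga, neg Gs], [pos Gx]),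
      ([pos Gt, pos Ga, neg Gt], [pos Gy]),
      (replicate L (pos Ga), [pos Gx, pos Gy]),
      (commutator Ga Gx, []),
      (commutator Gx Gy, []),
      (commutator Gy Ga, [])}"

definition snowflake_group :: "nat \<Rightarrow> snowflake_gen word set monoid" where
  "snowflake_group L = presented_group (snowflake_relations L)"

fun snowflake_len :: "nat \<Rightarrow> snowflake_gen \<Rightarrow> real" where
  "snowflake_len L Ga = 1"
| "snowflake_len L Gx = real L"
| "snowflake_len L Gy = real L"
| "snowflake_len L Gs = 1"
| "snowflake_len L Gt = 1"

definition snowflake_graph ::
  "nat \<Rightarrow> (snowflake_gen word set, snowflake_gen word set \<times> snowflake_gen) metric_graph" where
  "snowflake_graph L =
     cayley_graph (snowflake_group L)
       (\<lambda>\<sigma>. word_class (snowflake_relations L) [pos \<sigma>]) (snowflake_len L)"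

end

theory Submission
  imports Defs "HOL-Library.Product_Plus"
begin

text \<open>An isometric cycle is \<open>K\<close>-biLipschitz for every \<open>K > 1\<close>, so it suffices to find arbitrarily long
  isometric cycles. Let \<open>w\<^sub>0 = a\<close> and \<open>w\<^sub>k\<^sub>+\<^sub>1 = s w\<^sub>k s\<inverse> t w\<^sub>k t\<inverse>\<close>, a word for \<open>a\<close> to the power \<open>L\<^sup>k\<^sup>+\<^sup>1\<close>. The
  cycle is the commutator of \<open>s w\<^sub>k s\<inverse>\<close> and \<open>t w\<^sub>k t\<inverse>\<close>, which represent the commuting elements \<open>x\<^sup>n\<close> and \<open>y\<^sup>n\<close>
  with \<open>n = L\<^sup>k\<close>.

  A cycle is isometric once antipodal vertices are at distance half its length. Distances are bounded
  below by a function on the normal forms of the multiple HNN extension of \<open>\<langle>a, x, y\<rangle> = \<int>\<^sup>2\<close> that each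
  generator changes by at most its length: the cheapest way to pass through the cosets on the
  corresponding path of the Bass-Serre tree. An antipodal pair on opposite \<open>s\<close>-sides
  consists, up to left translation, of \<open>s p\<close> and \<open>y\<^sup>n s p'\<close>, where \<open>p\<close> and \<open>p'\<close> are prefixes of \<open>w\<^sub>k\<close> of total length \<open>|w\<^sub>k|\<close>.
  By induction on \<open>k\<close>, \<open>d(p, a\<^sup>i) + d(p', a\<^sup>i) \<ge> |w\<^sub>k|\<close> for all \<open>i\<close>. A path between the two points has to
  leave the first coset of \<open>\<langle>a\<rangle>\<close> and enter the second one, and
  crossing from \<open>x\<^sup>i\<close> to \<open>y\<^sup>n x\<^sup>j\<close> costs at least the lengths of \<open>x\<^sup>j\<^sup>-\<^sup>i\<close> and \<open>y\<^sup>n\<close> together; the first absorbs the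
  difference between \<open>a\<^sup>i\<close> and \<open>a\<^sup>j\<close>.\<close>

section \<open>Cycles with antipodal points far apart\<close>

lemma has_path_nonneg: "has_path \<Gamma> p r q \<Longrightarrow> 0 \<le> r"
  by (induction rule: has_path.induct) auto

lemma edge_point_in_points:
  assumes "e \<in> arcs \<Gamma>" "tail \<Gamma> e \<in> verts \<Gamma>" "head \<Gamma> e \<in> verts \<Gamma>" "u \<in> {0..len \<Gamma> e}"
  shows "edge_point \<Gamma> e u \<in> points \<Gamma>"
  using assms by (auto simp: edge_point_def points_def)

lemma has_path_trans:
  "has_path \<Gamma> p r q \<Longrightarrow> has_path \<Gamma> q r' s \<Longrightarrow> has_path \<Gamma> p (r + r') s"
proof (rotate_tac, induction rule: has_path.induct)
  case (segment q r' e u v)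
  then show ?case using has_path.segment[of \<Gamma> p "r + r'" e u v] by (simp add: add.assoc)
qed simp

lemma has_path_sym:
  assumes "\<forall>e\<in>arcs \<Gamma>. tail \<Gamma> e \<in> verts \<Gamma> \<and> head \<Gamma> e \<in> verts \<Gamma>"
  shows "has_path \<Gamma> p r q \<Longrightarrow> has_path \<Gamma> q r p"
proof (induction rule: has_path.induct)
  case (segment p r e u v)
  have "has_path \<Gamma> (edge_point \<Gamma> e v) (0 + \<bar>v - u\<bar>) (edge_point \<Gamma> e u)"
    by (rule has_path.segment[OF has_path.const]) (use segment assms in \<open>auto intro: edge_point_in_points\<close>)
  from has_path_trans[OF this segment.IH] show ?case
    by (simp add: abs_minus_commute add.commute)
qed (rule has_path.const)

lemma path_dist_eqI:
  assumes "has_path \<Gamma> p r q" "\<And>r'. has_path \<Gamma> p r' q \<Longrightarrow> r \<le> r'"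
  shows "path_dist \<Gamma> p q = r"
  unfolding path_dist_def by (rule cInf_eq_minimum) (use assms in auto)

lemma point_map_edge_point:
  assumes "combinatorial_map S \<Gamma> \<gamma>" "e \<in> arcs S" "len S e = len \<Gamma> (emap \<gamma> e)" "len S e > 0"
    "u \<in> {0..len S e}"
  shows "point_map \<Gamma> \<gamma> (edge_point S e u)
    = edge_point \<Gamma> (emap \<gamma> e) (if keeps \<gamma> e then u else len \<Gamma> (emap \<gamma> e) - u)"
  using assms by (auto simp: edge_point_def combinatorial_map_def)

lemma has_path_point_map:
  assumes "combinatorial_map S \<Gamma> \<gamma>"
    and len: "\<forall>e\<in>arcs S. len S e = len \<Gamma> (emap \<gamma> e) \<and> len S e > 0"
  shows "has_path S p r q \<Longrightarrow> has_path \<Gamma> (point_map \<Gamma> \<gamma> p) r (point_map \<Gamma> \<gamma> q)"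
proof (induction rule: has_path.induct)
  case (const p)
  then show ?case
    using assms by (intro has_path.const) (auto simp: points_def combinatorial_map_def)
next
  case (segment p r e u v)
  let ?t = "\<lambda>u. if keeps \<gamma> e then u else len \<Gamma> (emap \<gamma> e) - u"
  note pm = point_map_edge_point[OF assms(1) segment.hyps(2)] bspec[OF len segment.hyps(2)]
  have "has_path \<Gamma> (point_map \<Gamma> \<gamma> p) (r + \<bar>?t u - ?t v\<bar>) (edge_point \<Gamma> (emap \<gamma> e) (?t v))"
    by (rule has_path.segment) (use segment pm assms(1) in \<open>auto simp: combinatorial_map_def\<close>)
  then show ?case using segment pm by (auto simp: abs_minus_commute)
qed

text \<open>The potential \<open>\<Delta>\<close> bounds distances to vertices from the point of \<open>E\<close> at distance \<open>x\<close> from its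
  tail.\<close>

lemma has_path_potential:
  fixes \<Gamma> :: "('v, 'e, 'm) metric_graph_scheme" and \<Delta> :: "'v \<Rightarrow> real"
  assumes lip: "\<And>e. e \<in> arcs \<Gamma> \<Longrightarrow> \<bar>\<Delta> (tail \<Gamma> e) - \<Delta> (head \<Gamma> e)\<bar> \<le> len \<Gamma> e"
    and E: "E \<in> arcs \<Gamma>" "\<Delta> (tail \<Gamma> E) \<le> x" "\<Delta> (head \<Gamma> E) \<le> len \<Gamma> E - x" "x \<in> {0..len \<Gamma> E}"
    and path: "has_path \<Gamma> (edge_point \<Gamma> E x) r (edge_point \<Gamma> e v)"
    and e: "e \<in> arcs \<Gamma>" "v \<in> {0..len \<Gamma> e}" "e \<noteq> E"
  shows "min (\<Delta> (tail \<Gamma> e) + v) (\<Delta> (head \<Gamma> e) + len \<Gamma> e - v) \<le> r"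
proof -
  \<comment> \<open>Extends \<open>\<Delta>\<close> to points: an inner point is reached through an
    end of its edge or, inside \<open>E\<close>, directly along \<open>E\<close>. By
    \<open>upper\<close> and \<open>lower\<close> this is a minimum also at the ends of an edge,
    hence 1-Lipschitz along segments.\<close>
  define \<phi> where "\<phi> p = (case p of Vertex w \<Rightarrow> \<Delta> w
    | Inner e v \<Rightarrow> let m = min (\<Delta> (tail \<Gamma> e) + v) (\<Delta> (head \<Gamma> e) + len \<Gamma> e - v)
        in if e = E then min m \<bar>v - x\<bar> else m)" for p
  have upper: "\<phi> (edge_point \<Gamma> e v) \<le> \<Delta> (tail \<Gamma> e) + v"
      "\<phi> (edge_point \<Gamma> e v) \<le> \<Delta> (head \<Gamma> e) + len \<Gamma> e - v"
      "e = E \<Longrightarrow> \<phi> (edge_point \<Gamma> e v) \<le> \<bar>v - x\<bar>"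
    if "e \<in> arcs \<Gamma>" "v \<in> {0..len \<Gamma> e}" for e v
    using lip[OF that(1)] that E by (auto simp: \<phi>_def edge_point_def Let_def min_def abs_if)
  have lower: "\<phi> (edge_point \<Gamma> e v) = \<Delta> (tail \<Gamma> e) + v
      \<or> \<phi> (edge_point \<Gamma> e v) = \<Delta> (head \<Gamma> e) + len \<Gamma> e - v
      \<or> e = E \<and> \<phi> (edge_point \<Gamma> e v) = \<bar>v - x\<bar>" for e v
    by (auto simp: \<phi>_def edge_point_def Let_def min_def)
  have "has_path \<Gamma> p r q \<Longrightarrow> p = edge_point \<Gamma> E x \<Longrightarrow> \<phi> q \<le> r" for p q
  proof (induction rule: has_path.induct)
    case (const p)
    then show ?case using upper(3)[OF E(1,4)] by simp
  next
    case (segment p r e u v)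
    have "\<phi> (edge_point \<Gamma> e v) \<le> \<phi> (edge_point \<Gamma> e u) + \<bar>u - v\<bar>"
    proof (cases "e = E \<and> \<phi> (edge_point \<Gamma> e u) = \<bar>u - x\<bar>")
      case True
      then show ?thesis using upper(3)[OF segment.hyps(2,4)] by linarith
    next
      case False
      then show ?thesis using lower[of e u] upper(1,2)[OF segment.hyps(2,4)] by linarith
    qed
    then show ?case using segment by simp
  qed
  from this[OF path] show ?thesis using lower[of e v] e(3) by auto
qed

section \<open>Circles with unit edges\<close>

text \<open>Arc length parametrization by \<open>x \<ge> 0\<close>. Values above \<open>N\<close>
  are allowed, so that an arc through vertex 0 is also an interval of parameters.\<close>

definition circle_point :: "nat \<Rightarrow> (nat \<Rightarrow> real) \<Rightarrow> real \<Rightarrow> (nat, nat) point" where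
  "circle_point N l x = edge_point (circle N l) (nat \<lfloor>x\<rfloor> mod N) (x - real_of_int \<lfloor>x\<rfloor>)"

lemma circle_point_edge:
  assumes "N > 0" "\<forall>i<N. l i = 1" "real i \<le> x" "x \<le> real i + 1"
  shows "circle_point N l x = edge_point (circle N l) (i mod N) (x - real i)"
proof (cases "x = real i + 1")
  case True
  then have "\<lfloor>x\<rfloor> = int (Suc i)" by simp
  then have "nat \<lfloor>x\<rfloor> = Suc i" "real_of_int \<lfloor>x\<rfloor> = real i + 1" by simp_all
  with assms(1) assms(2) True show ?thesis
    by (simp add: circle_point_def edge_point_def circle_def mod_Suc_eq)
next
  case False
  then have "\<lfloor>x\<rfloor> = int i" using assms by linarith
  then show ?thesis by (simp add: circle_point_def)
qed

lemma circle_point_periodic: "x \<ge> 0 \<Longrightarrow> circle_point N l (x + real N) = circle_point N l x"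
  using floor_add_int[of x "int N"] by (simp add: circle_point_def nat_add_distrib)

lemma points_circle:
  assumes "N > 0" "\<forall>i<N. l i = 1" "p \<in> points (circle N l)"
  obtains x where "0 \<le> x" "x < real N" "p = circle_point N l x"
proof -
  consider i where "i < N" "p = Vertex i" | i u where "i < N" "0 < u" "u < 1" "p = Inner i u"
    using assms(2,3) by (auto simp: points_def circle_def)
  then show ?thesis
  proof cases
    case (1 i)
    then show ?thesis
      using circle_point_edge[OF assms(1,2), of i "real i"] that[of "real i"]
      by (simp add: edge_point_def circle_def)
  next
    case (2 i u)
    then show ?thesis
      using circle_point_edge[OF assms(1,2), of i "real i + u"] that[of "real i + u"] assms(2)
      by (simp add: edge_point_def circle_def)
  qed
qed

lemma has_path_circle:
  assumes N: "N > 0" and l: "\<forall>i<N. l i = 1" and "0 \<le> x" "x \<le> y"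
  shows "has_path (circle N l) (circle_point N l x) (y - x) (circle_point N l y)"
proof -
  define i where "i = nat \<lfloor>x\<rfloor>"
  have i: "real i \<le> x" "x \<le> real i + 1" using assms unfolding i_def by linarith+
  let ?S = "circle N l"
  have arc: "j mod N \<in> arcs ?S" "len ?S (j mod N) = 1"
    "tail ?S (j mod N) \<in> verts ?S" "head ?S (j mod N) \<in> verts ?S" for j
    using N l by (simp_all add: circle_def)
  have "has_path ?S (circle_point N l x) (y - x) (circle_point N l y)"
    if "x \<le> y" "real (i + n) \<le> y" "y \<le> real (i + n) + 1" for n y
    using that
  proof (induction n arbitrary: y)
    case 0
    have "has_path ?S (edge_point ?S (i mod N) (x - real i))
        (0 + \<bar>(x - real i) - (y - real i)\<bar>) (edge_point ?S (i mod N) (y - real i))"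
      using 0 i arc by (intro has_path.segment has_path.const edge_point_in_points) auto
    then show ?case
      using circle_point_edge[OF N l, of i x] circle_point_edge[OF N l, of i y] 0 i by simp
  next
    case (Suc n)
    let ?j = "i + Suc n"
    have "has_path ?S (circle_point N l x) (real ?j - x) (circle_point N l (real ?j))"
      using Suc.IH[of "real ?j"] i by simp
    then have "has_path ?S (circle_point N l x) (real ?j - x) (edge_point ?S (?j mod N) 0)"
      using circle_point_edge[OF N l, of ?j "real ?j"] by simp
    then have "has_path ?S (circle_point N l x) (real ?j - x + \<bar>0 - (y - real ?j)\<bar>)
        (edge_point ?S (?j mod N) (y - real ?j))"
      using Suc.prems arc by (intro has_path.segment) auto
    then show ?case
      using circle_point_edge[OF N l, of ?j y] Suc.prems by simp
  qed
  moreover define n where "n = nat (\<lfloor>y\<rfloor> - \<lfloor>x\<rfloor>)"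
  have "int (i + n) = \<lfloor>y\<rfloor>" using assms(3,4) floor_mono[of x y] by (simp add: n_def i_def)
  then have "real (i + n) \<le> y" "y \<le> real (i + n) + 1" by linarith+
  ultimately show ?thesis using assms(4) by blast
qed

text \<open>A path shorter than an arc of length at most \<open>M\<close> from \<open>x\<close> to
  \<open>y\<close> could be prolonged along the circle to the antipode of \<open>x\<close>, so
  bounding distances between antipodal points is enough. The functions \<open>\<delta> i\<close> do
  this for vertices.\<close>

theorem isometric_cycle_if_antipodal:
  fixes \<Gamma> :: "('v, 'e, 'm) metric_graph_scheme" and \<delta> :: "nat \<Rightarrow> 'v \<Rightarrow> real"
  assumes cyc: "is_cycle \<Gamma> (2 * M, \<gamma>)" and M: "2 \<le> M"
    and unit: "\<And>i. i < 2 * M \<Longrightarrow> len \<Gamma> (emap \<gamma> i) = 1"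
    and verts: "\<forall>e\<in>arcs \<Gamma>. tail \<Gamma> e \<in> verts \<Gamma> \<and> head \<Gamma> e \<in> verts \<Gamma>"
    and lip: "\<And>i e. i < 2 * M \<Longrightarrow> e \<in> arcs \<Gamma> \<Longrightarrow> \<bar>\<delta> i (tail \<Gamma> e) - \<delta> i (head \<Gamma> e)\<bar> \<le> len \<Gamma> e"
    and zero: "\<And>i. i < 2 * M \<Longrightarrow> \<delta> i (vmap \<gamma> i) = 0"
    and antipode: "\<And>i. i < 2 * M \<Longrightarrow> real M \<le> \<delta> i (vmap \<gamma> ((i + M) mod (2 * M)))"
  shows "isometric_cycle \<Gamma> (2 * M, \<gamma>)"
proof -
  define N where "N = 2 * M"
  define l where "l i = len \<Gamma> (emap \<gamma> i)" for i
  let ?S = "circle N l" and ?P = "circle_point N l" and ?f = "point_map \<Gamma> \<gamma>"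
  have N: "N > 0" using M by (simp add: N_def)
  have l: "\<forall>i<N. l i = 1" using unit by (simp add: l_def N_def)
  have S: "cycle_domain \<Gamma> (2 * M, \<gamma>) = ?S" by (simp add: cycle_domain_def N_def l_def[abs_def])
  have map: "combinatorial_map ?S \<Gamma> \<gamma>" using cyc by (simp add: is_cycle_def S)
  have arc: "\<forall>e\<in>arcs ?S. len ?S e = len \<Gamma> (emap \<gamma> e) \<and> len ?S e > 0"
    using l by (simp add: circle_def l_def)
  have vS: "\<forall>e\<in>arcs ?S. tail ?S e \<in> verts ?S \<and> head ?S e \<in> verts ?S"
    using N by (simp add: circle_def)
  note push = has_path_point_map[OF map arc]
  have edge: "emap \<gamma> i \<in> arcs \<Gamma>" "len \<Gamma> (emap \<gamma> i) = 1"
    "if keeps \<gamma> i then tail \<Gamma> (emap \<gamma> i) = vmap \<gamma> i \<and> head \<Gamma> (emap \<gamma> i) = vmap \<gamma> (Suc i mod N)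
     else tail \<Gamma> (emap \<gamma> i) = vmap \<gamma> (Suc i mod N) \<and> head \<Gamma> (emap \<gamma> i) = vmap \<gamma> i" if "i < N" for i
    using map that unit[of i] by (auto simp: combinatorial_map_def circle_def N_def)
  have step: "\<bar>\<delta> j (vmap \<gamma> i) - \<delta> j (vmap \<gamma> (Suc i mod N))\<bar> \<le> 1" if "i < N" "j < N" for i j
    using lip[of j "emap \<gamma> i"] edge[OF that(1)] that
    by (cases "keeps \<gamma> i") (simp_all add: N_def abs_minus_commute)
  have far: "real M \<le> r" if "0 \<le> x" and path: "has_path \<Gamma> (?f (?P x)) r (?f (?P (x + real M)))" for x r
  proof -
    define a where "a = nat \<lfloor>x\<rfloor>"
    define u where "u = x - real a"
    have u: "0 \<le> u" "u \<le> 1" using that(1) unfolding u_def a_def by linarith+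
    define i j where "i = a mod N" and "j = (a + M) mod N"
    have ij: "i < N" "j < N" using N by (simp_all add: i_def j_def)
    have j: "j = (i + M) mod N" by (simp add: i_def j_def mod_add_left_eq)
    have Sj: "Suc j mod N = (Suc i mod N + M) mod N"
      by (simp add: j mod_Suc_eq mod_add_left_eq)
    have Px: "?P x = edge_point ?S i u"
      using circle_point_edge[OF N l, of a x] u by (simp add: i_def u_def)
    have Py: "?P (x + real M) = edge_point ?S j u"
      using circle_point_edge[OF N l, of "a + M" "x + real M"] u by (simp add: j_def u_def)
    define i' where "i' = Suc i mod N"
    have i': "i' < N" using N by (simp add: i'_def)
    \<comment> \<open>The point at distance \<open>u\<close> along edge \<open>i\<close> is left
      through one of its ends \<open>i\<close> and \<open>i'\<close>, so the smaller of their two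
      bounds serves.\<close>
    define \<Delta> where "\<Delta> w = min (\<delta> i w + u) (\<delta> i' w + 1 - u)" for w
    define x' y' where "x' = (if keeps \<gamma> i then u else 1 - u)" and "y' = (if keeps \<gamma> j then u else 1 - u)"
    have pts: "?f (?P x) = edge_point \<Gamma> (emap \<gamma> i) x'" "?f (?P (x + real M)) = edge_point \<Gamma> (emap \<gamma> j) y'"
      unfolding Px Py x'_def y'_def
      using point_map_edge_point[OF map, of i u] point_map_edge_point[OF map, of j u] arc
        edge[OF ij(1)] edge[OF ij(2)] ij u by (simp_all add: circle_def)
    have near: "\<Delta> (vmap \<gamma> i) \<le> u" "\<Delta> (vmap \<gamma> i') \<le> 1 - u"
      using zero[of i] zero[of i'] ij i' by (simp_all add: \<Delta>_def N_def)
    have dj: "real M \<le> \<delta> i (vmap \<gamma> j)" using antipode[of i] ij by (simp add: j N_def)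
    have dj': "real M \<le> \<delta> i' (vmap \<gamma> (Suc j mod N))"
      using antipode[of i'] i' unfolding Sj i'_def by (simp add: N_def)
    have "\<delta> i (vmap \<gamma> (Suc j mod N)) \<ge> real M - 1" "\<delta> i' (vmap \<gamma> j) \<ge> real M - 1"
      using step[OF ij(2) ij(1)] step[OF ij(2) i'] dj dj' by linarith+
    then have away: "real M - u \<le> \<Delta> (vmap \<gamma> j)" "real M - 1 + u \<le> \<Delta> (vmap \<gamma> (Suc j mod N))"
      using dj dj' u by (simp_all add: \<Delta>_def)
    \<comment> \<open>\<open>has_path_potential\<close> needs distinct edges:
      \<open>\<delta> i\<close> is at most 1 at both ends of edge \<open>i\<close>, but at least
      \<open>M \<ge> 2\<close> at vertex \<open>j\<close>.\<close>
    have "\<delta> i (vmap \<gamma> i) = 0" "\<delta> i (vmap \<gamma> i') \<le> 1"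
      using zero[of i] step[OF ij(1,1)] ij by (auto simp: N_def i'_def)
    then have "vmap \<gamma> j \<noteq> vmap \<gamma> i" "vmap \<gamma> j \<noteq> vmap \<gamma> i'" using dj M by auto
    then have ne: "emap \<gamma> j \<noteq> emap \<gamma> i"
      using edge(3)[OF ij(1)] edge(3)[OF ij(2)] by (auto simp: i'_def split: if_splits)
    have "min (\<Delta> (tail \<Gamma> (emap \<gamma> j)) + y') (\<Delta> (head \<Gamma> (emap \<gamma> j)) + len \<Gamma> (emap \<gamma> j) - y') \<le> r"
    proof (rule has_path_potential[of \<Gamma> \<Delta> "emap \<gamma> i" x'])
      show "\<bar>\<Delta> (tail \<Gamma> e) - \<Delta> (head \<Gamma> e)\<bar> \<le> len \<Gamma> e" if "e \<in> arcs \<Gamma>" for e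
        using lip[of i e] lip[of i' e] that ij i' unfolding \<Delta>_def N_def by (auto simp: min_def abs_if split: if_splits)
      show "\<Delta> (tail \<Gamma> (emap \<gamma> i)) \<le> x'" "\<Delta> (head \<Gamma> (emap \<gamma> i)) \<le> len \<Gamma> (emap \<gamma> i) - x'"
        using edge[OF ij(1)] near by (auto simp: x'_def i'_def)
    qed (use edge ij u ne path pts in \<open>auto simp: x'_def y'_def\<close>)
    then show ?thesis
      using edge[OF ij(2)] away u by (auto simp: y'_def split: if_splits)
  qed
  have iso: "path_dist \<Gamma> (?f (?P x)) (?f (?P y)) = y - x" "path_dist ?S (?P x) (?P y) = y - x"
     "path_dist \<Gamma> (?f (?P y)) (?f (?P x)) = y - x" "path_dist ?S (?P y) (?P x) = y - x"
    if "0 \<le> x" "x \<le> y" "y \<le> x + real M" for x y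
  proof -
    have p: "has_path ?S (?P x) (y - x) (?P y)" using has_path_circle[OF N l that(1,2)] .
    have "has_path ?S (?P y) (x + real M - y) (?P (x + real M))"
      using has_path_circle[OF N l, of y "x + real M"] that by simp
    from push[OF this] have low: "y - x \<le> r" if "has_path \<Gamma> (?f (?P x)) r (?f (?P y))" for r
      using far[OF \<open>0 \<le> x\<close> has_path_trans[OF that]] by fastforce
    then show "path_dist \<Gamma> (?f (?P x)) (?f (?P y)) = y - x" by (rule path_dist_eqI[OF push[OF p]])
    show "path_dist ?S (?P x) (?P y) = y - x" by (rule path_dist_eqI[OF p low[OF push]])
    note symS = has_path_sym[OF vS] and sym\<Gamma> = has_path_sym[OF verts]
    show "path_dist \<Gamma> (?f (?P y)) (?f (?P x)) = y - x" by (rule path_dist_eqI[OF sym\<Gamma>[OF push[OF p]] low[OF sym\<Gamma>]])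
    show "path_dist ?S (?P y) (?P x) = y - x" by (rule path_dist_eqI[OF symS[OF p] low[OF push[OF symS]]])
  qed
  have ordered: "path_dist \<Gamma> (?f (?P x)) (?f (?P y)) = path_dist ?S (?P x) (?P y) \<and>
      path_dist \<Gamma> (?f (?P y)) (?f (?P x)) = path_dist ?S (?P y) (?P x)"
    if "0 \<le> x" "x \<le> y" "y < real N" for x y
  proof (cases "y \<le> x + real M")
    case True
    then show ?thesis using iso[of x y] that by simp
  next
    \<comment> \<open>Past half a turn the complementary arc, from \<open>y\<close> to
      \<open>x + N\<close>, is the short one.\<close>
    case False
    then show ?thesis
      using iso[of y "x + real N"] that circle_point_periodic[of x N l] by (simp add: N_def)
  qed
  have "path_dist \<Gamma> (?f p) (?f q) = path_dist ?S p q" if pq: "p \<in> points ?S" "q \<in> points ?S" for p q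
  proof -
    obtain x where x: "0 \<le> x" "x < real N" "p = ?P x" using points_circle[OF N l pq(1)] by blast
    obtain y where y: "0 \<le> y" "y < real N" "q = ?P y" using points_circle[OF N l pq(2)] by blast
    show ?thesis using ordered[of x y] ordered[of y x] x y by (cases "x \<le> y") auto
  qed
  then show ?thesis using cyc by (simp add: isometric_cycle_def S)
qed

lemma path_dist_nonneg:
  assumes "has_path \<Gamma> p r q"
  shows "0 \<le> path_dist \<Gamma> p q"
  unfolding path_dist_def by (rule cInf_greatest) (use assms in \<open>auto intro: has_path_nonneg\<close>)

lemma path_dist_circle_nonneg:
  assumes "N > 0" "\<forall>i<N. l i = 1" "p \<in> points (circle N l)" "q \<in> points (circle N l)"
  shows "0 \<le> path_dist (circle N l) p q"
proof -
  obtain x where x: "0 \<le> x" "x < real N" "p = circle_point N l x"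
    by (rule points_circle[OF assms(1-3)])
  obtain y where y: "0 \<le> y" "y < real N" "q = circle_point N l y"
    by (rule points_circle[OF assms(1,2,4)])
  have "has_path (circle N l) p (y + real N - x) q"
    using has_path_circle[OF assms(1,2), of x "y + real N"] circle_point_periodic[of y N l] x y by simp
  then show ?thesis by (rule path_dist_nonneg)
qed

section \<open>Lengths in the vertex group\<close>

lemma INF_nat_attained:
  fixes F :: "'a \<Rightarrow> nat"
  obtains r where "(INF r. F r) = F r"
  using Inf_nat_def1[of "range F"] by auto

lemma INF_nat_le: "(INF r. F r) \<le> (F r :: nat)"
  by (rule cINF_lower) auto

locale snowflake =
  fixes L :: nat
  assumes L_ge: "6 \<le> L"
begin

text \<open>\<open>cost n c\<close>: the element \<open>a\<^sup>n\<close> has a word of length \<open>c\<close> obtained by inserting letters \<open>a\<close> and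
  replacing powers \<open>a\<^sup>L\<^sup>r = x\<^sup>r y\<^sup>r\<close> by \<open>s a\<^sup>r s\<inverse> t a\<^sup>r t\<inverse>\<close>. The minimum \<open>f n\<close> turns out to be the word length of
  \<open>a\<^sup>n\<close>, and \<open>g n\<close> below that of \<open>x\<^sup>n\<close> and \<open>y\<^sup>n\<close>.\<close>

inductive cost :: "int \<Rightarrow> nat \<Rightarrow> bool" where
  zero: "cost 0 0"
| step: "cost n c \<Longrightarrow> \<bar>d\<bar> = 1 \<Longrightarrow> cost (n + d) (c + 1)"
| jump: "cost n c \<Longrightarrow> cost r c' \<Longrightarrow> cost (n + int L * r) (c + 2 * c' + 4)"

lemma cost_add: "cost m c \<Longrightarrow> cost n c' \<Longrightarrow> cost (m + n) (c + c')"
proof (induction rule: cost.induct)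
  case (step m c d)
  then show ?case using cost.step[of "m + n" "c + c'" d] by (simp add: algebra_simps)
next
  case (jump m c r c'')
  then show ?case using cost.jump[of "m + n" "c + c'" r c''] by (simp add: algebra_simps)
qed simp

lemma cost_minus: "cost n c \<Longrightarrow> cost (- n) c"
proof (induction rule: cost.induct)
  case (step n c d)
  then show ?case using cost.step[of "- n" c "- d"] by simp
next
  case (jump n c r c')
  then show ?case using cost.jump[of "- n" c "- r" c'] by simp
qed (simp add: cost.zero)

lemma cost_abs: "cost n (nat \<bar>n\<bar>)"
proof -
  have "cost (int k) k" for k
    by (induction k) (use cost.zero cost.step[of _ _ 1] in \<open>force simp: add.commute\<close>)+
  then show ?thesis
    using cost_minus[of "- n" "nat (- n)"] by (cases "n \<ge> 0") (metis abs_of_nonneg int_nat_eq,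
      metis abs_of_neg int_nat_eq linorder_not_le minus_minus neg_0_le_iff_le order_less_imp_le)
qed

definition f :: "int \<Rightarrow> nat" where "f n = (LEAST c. cost n c)"

lemma cost_f: "cost n (f n)"
  unfolding f_def by (rule LeastI, rule cost_abs)

lemma f_le: "cost n c \<Longrightarrow> f n \<le> c"
  unfolding f_def by (rule Least_le)

lemma f_le_abs: "f n \<le> nat \<bar>n\<bar>"
  by (rule f_le[OF cost_abs])

lemma f_zero [simp]: "f 0 = 0"
  using f_le_abs[of 0] by simp

lemma f_add: "f (m + n) \<le> f m + f n"
  by (rule f_le, rule cost_add; rule cost_f)

lemma f_jump: "f (n + int L * r) \<le> f n + 2 * f r + 4"
  by (rule f_le, rule cost.jump; rule cost_f)

lemma f_minus [simp]: "f (- n) = f n"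
  using f_le[OF cost_minus[OF cost_f, of n]] f_le[OF cost_minus[OF cost_f, of "- n"]] by simp

lemma f_one_le: "n \<noteq> 0 \<Longrightarrow> 1 \<le> f n"
proof -
  have "cost n c \<Longrightarrow> n \<noteq> 0 \<Longrightarrow> 1 \<le> c" for c
    by (induction rule: cost.induct) auto
  then show "n \<noteq> 0 \<Longrightarrow> 1 \<le> f n" using cost_f by blast
qed

definition g :: "int \<Rightarrow> nat" where "g r = (if r = 0 then 0 else f r + 2)"

lemma g_zero [simp]: "g 0 = 0" by (simp add: g_def)

lemma g_minus [simp]: "g (- r) = g r" by (simp add: g_def)

lemma g_add: "g (m + n) \<le> g m + g n"
  using f_add[of m n] by (auto simp: g_def)

lemma f_le_g: "f r \<le> g r" and g_le_f: "g r \<le> f r + 2"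
  by (auto simp: g_def)

lemma g_le_abs: "g r \<le> 3 * nat \<bar>r\<bar>"
  using f_le_abs[of r] by (auto simp: g_def)

lemma g_lipschitz: "g m \<le> g r + 3 * nat \<bar>m - r\<bar>"
  using g_add[of r "m - r"] g_le_abs[of "m - r"] by simp

lemma g_le_diff: "g m \<le> g r + g (r - m)"
  using g_add[of r "m - r"] g_minus[of "m - r"] by simp

text \<open>The pair \<open>(i, j)\<close> stands for \<open>a\<^sup>i x\<^sup>j\<close>, which is also the product of \<open>i - L r\<close> letters \<open>a\<close>,
  \<open>j + r\<close> letters \<open>x\<close> and \<open>r\<close> letters \<open>y\<close>.\<close>

definition \<nu> :: "int \<times> int \<Rightarrow> nat" where
  "\<nu> h = (INF r. nat \<bar>fst h - int L * r\<bar> + g (snd h + r) + g r)"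

lemma \<nu>_le: "\<nu> (i, j) \<le> nat \<bar>i - int L * r\<bar> + g (j + r) + g r"
  unfolding \<nu>_def using INF_nat_le[of "\<lambda>r. nat \<bar>i - int L * r\<bar> + g (j + r) + g r" r] by simp

lemma \<nu>_attained:
  obtains r where "\<nu> (i, j) = nat \<bar>i - int L * r\<bar> + g (j + r) + g r"
  using INF_nat_attained[of "\<lambda>r. nat \<bar>i - int L * r\<bar> + g (j + r) + g r"]
  unfolding \<nu>_def fst_conv snd_conv by blast

lemma \<nu>_zero [simp]: "\<nu> 0 = 0"
  using \<nu>_le[of 0 0 0] by (simp add: zero_prod_def)

lemma \<nu>_add: "\<nu> (h + h') \<le> \<nu> h + \<nu> h'"
proof -
  obtain i j i' j' where h: "h = (i, j)" "h' = (i', j')" by fastforce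
  obtain r where r: "\<nu> (i, j) = nat \<bar>i - int L * r\<bar> + g (j + r) + g r" by (rule \<nu>_attained)
  obtain r' where r': "\<nu> (i', j') = nat \<bar>i' - int L * r'\<bar> + g (j' + r') + g r'" by (rule \<nu>_attained)
  have "nat \<bar>i + i' - int L * (r + r')\<bar> \<le> nat \<bar>i - int L * r\<bar> + nat \<bar>i' - int L * r'\<bar>"
    by (simp add: ring_distribs)
  moreover have "g (j + j' + (r + r')) \<le> g (j + r) + g (j' + r')"
    using g_add[of "j + r" "j' + r'"] by (simp add: algebra_simps)
  ultimately show ?thesis
    using \<nu>_le[of "i + i'" "j + j'" "r + r'"] g_add[of r r'] r r' h by simp
qed

lemma \<nu>_minus [simp]: "\<nu> (- h) = \<nu> h"
proof -
  have "\<nu> (- h) \<le> \<nu> h" for h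
  proof -
    obtain i j where h: "h = (i, j)" by (rule prod.exhaust)
    obtain r where r: "\<nu> (i, j) = nat \<bar>i - int L * r\<bar> + g (j + r) + g r" by (rule \<nu>_attained)
    have "g (- j + - r) = g (j + r)" using g_minus[of "j + r"] by simp
    moreover have "\<bar>- i - int L * - r\<bar> = \<bar>i - int L * r\<bar>" by simp
    ultimately show ?thesis using \<nu>_le[of "- i" "- j" "- r"] r h by simp
  qed
  from this[of h] this[of "- h"] show ?thesis by simp
qed

text \<open>The main use of \<open>L \<ge> 6\<close>: changing the number of letters
  \<open>y\<close> from \<open>r\<close> to \<open>q\<close> changes two values of \<open>g\<close>
  by at most \<open>3 * \<bar>r - q\<bar>\<close> each (\<open>g_lipschitz\<close>), and the letters
  \<open>a\<close> pay for both.\<close>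

lemma L_abs: "6 * nat \<bar>r - q\<bar> \<le> nat \<bar>i - int L * r\<bar> + nat \<bar>i - int L * q\<bar>"
proof -
  have "6 * \<bar>r - q\<bar> \<le> int L * \<bar>r - q\<bar>"
    using L_ge by (intro mult_right_mono) auto
  also have "\<dots> = \<bar>int L * r - int L * q\<bar>"
    by (simp add: abs_mult flip: right_diff_distrib)
  finally have "6 * \<bar>r - q\<bar> \<le> \<bar>int L * r - int L * q\<bar>" .
  moreover have "6 * nat \<bar>d\<bar> \<le> nat \<bar>i - u\<bar> + nat \<bar>i - v\<bar>" if "6 * \<bar>d\<bar> \<le> \<bar>u - v\<bar>" for d u v :: int
    using that by linarith
  ultimately show ?thesis by blast
qed

section \<open>The cyclic subgroups generated by \<open>a\<close>, \<open>x\<close> and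
  \<open>y\<close>\<close>

text \<open>The coordinates of \<open>d^k\<close>, using \<open>y = a^L x^{-1}\<close>. The values
  at \<open>Gs\<close> and \<open>Gt\<close> are defaults.\<close>

fun vec :: "snowflake_gen \<Rightarrow> int \<Rightarrow> int \<times> int" where
  "vec Gx k = (0, k)"
| "vec Gy k = (int L * k, - k)"
| "vec _ k = (k, 0)"

lemma vec_add: "vec d (j + k) = vec d j + vec d k"
  by (cases d) (auto simp: algebra_simps)

lemma vec_diff: "vec d (j - k) = vec d j - vec d k"
  by (cases d) (auto simp: algebra_simps)

lemma vec_minus: "vec d (- k) = - vec d k"
  by (cases d) (auto simp: algebra_simps)

lemma vec_zero [simp]: "vec d 0 = 0"
  by (cases d) (auto simp: zero_prod_def)

text \<open>The outermost jumps of a derivation of \<open>cost n c\<close> merge into one, whose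
  size is the sum of theirs, since \<open>g\<close> is subadditive. Conversely, writing
  \<open>a^n\<close> with \<open>r\<close> letters \<open>y\<close> is a single jump.\<close>

lemma \<nu>_a: "\<nu> (vec Ga n) = f n"
proof (rule antisym)
  have "\<exists>r. nat \<bar>n - int L * r\<bar> + 2 * g r \<le> c" if "cost n c" for c
    using that
  proof (induction rule: cost.induct)
    case zero
    then show ?case by (intro exI[of _ 0]) simp
  next
    case (step n c d)
    then obtain r where "nat \<bar>n - int L * r\<bar> + 2 * g r \<le> c" by blast
    with step show ?case by (intro exI[of _ r]) linarith
  next
    case (jump n c r c')
    then obtain q where q: "nat \<bar>n - int L * q\<bar> + 2 * g q \<le> c" by blast
    have "g (q + r) \<le> g q + (c' + 2)"
      using g_add[of q r] g_le_f[of r] f_le[OF jump.hyps(2)] by linarith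
    moreover have "n + int L * r - int L * (q + r) = n - int L * q"
      by (simp add: algebra_simps)
    ultimately show ?case
      using q by (intro exI[of _ "q + r"]) simp
  qed
  from this[OF cost_f] obtain r where r: "nat \<bar>n - int L * r\<bar> + 2 * g r \<le> f n" ..
  then show "\<nu> (vec Ga n) \<le> f n" using \<nu>_le[of n 0 r] by simp
next
  obtain r where r: "\<nu> (n, 0) = nat \<bar>n - int L * r\<bar> + g (0 + r) + g r"
    by (rule \<nu>_attained)
  show "f n \<le> \<nu> (vec Ga n)"
  proof (cases "r = 0")
    case True
    then show ?thesis using r f_le_abs[of n] by simp
  next
    case False
    then have "f n \<le> f (n - int L * r) + 2 * g r"
      using f_jump[of "n - int L * r" r] by (simp add: g_def)
    then show ?thesis using r f_le_abs[of "n - int L * r"] by simp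
  qed
qed

text \<open>Using \<open>r\<close> letters \<open>y\<close> instead of \<open>k\<close> saves at
  most \<open>3 * \<bar>k - r\<bar>\<close> in each value of \<open>g\<close> but needs at least
  \<open>6 * \<bar>k - r\<bar>\<close> letters \<open>a\<close>. So mixing in \<open>a\<close> never
  shortens \<open>x^j y^k\<close>.\<close>

lemma \<nu>_xy:
  assumes "(d, d') = (Gx, Gy) \<or> (d, d') = (Gy, Gx)"
  shows "g j + g k \<le> \<nu> (vec d j + vec d' k)"
proof -
  have *: "g j + g k \<le> \<nu> (vec Gx j + vec Gy k)" for j k
  proof -
    have eq: "vec Gx j + vec Gy k = (int L * k, j - k)" by simp
    obtain r where r: "\<nu> (int L * k, j - k) = nat \<bar>int L * k - int L * r\<bar> + g (j - k + r) + g r"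
      by (rule \<nu>_attained)
    have "6 * nat \<bar>k - r\<bar> \<le> nat \<bar>int L * k - int L * r\<bar>"
      using L_abs[of k r "int L * k"] by simp
    with r g_lipschitz[of k r] g_lipschitz[of j "j - k + r"] show ?thesis
      unfolding eq by simp
  qed
  from assms *[of j k] *[of k j] show ?thesis by (auto simp: add.commute)
qed

lemma \<nu>_le_g: assumes "d \<in> {Gx, Gy}" shows "\<nu> (vec d k) \<le> g k"
  using assms \<nu>_le[of 0 k 0] \<nu>_le[of "int L * k" "- k" k] by auto

lemma \<nu>_vec: assumes "d \<in> {Gx, Gy}" shows "\<nu> (vec d k) = g k"
proof (rule antisym)
  show "g k \<le> \<nu> (vec d k)"
    using assms \<nu>_xy[of Gx Gy k 0] \<nu>_xy[of Gy Gx k 0] by auto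
qed (rule \<nu>_le_g[OF assms])

lemma f_mult_L: "f (int L * m) = 2 * g m"
proof (rule antisym)
  show "f (int L * m) \<le> 2 * g m"
    using f_jump[of 0 m] by (simp add: g_def)
  have "vec Ga (int L * m) = vec Gx m + vec Gy m" by simp
  then show "2 * g m \<le> f (int L * m)"
    using \<nu>_xy[of Gx Gy m m] \<nu>_a[of "int L * m"] by simp
qed

end

section \<open>Normal forms\<close>

text \<open>A state \<open>([(q\<^sub>n, l\<^sub>n), \<dots>, (q\<^sub>1, l\<^sub>1)], h)\<close> is the normal form \<open>c\<^sub>1 l\<^sub>1 \<dots> c\<^sub>n l\<^sub>n h\<close>, where \<open>l\<^sub>i\<close> is a letter
  \<open>s\<^sup>\<plusminus>\<^sup>1\<close> or \<open>t\<^sup>\<plusminus>\<^sup>1\<close> and \<open>c\<^sub>i\<close> is the representative \<open>lift (src l\<^sub>i) q\<^sub>i\<close> of a coset of \<open>\<langle>src l\<^sub>i\<rangle>\<close>. Crossing \<open>l\<close> from the left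
  to the right turns powers of \<open>src l\<close> into powers of \<open>tgt l\<close>.\<close>

type_synonym letter = "snowflake_gen \<times> bool"
type_synonym stack = "(int \<times> letter) list"

fun inv_letter :: "letter \<Rightarrow> letter" where
  "inv_letter (z, b) = (z, \<not> b)"

lemma inv_letter_inv [simp]: "inv_letter (inv_letter l) = l" and fst_inv_letter [simp]: "fst (inv_letter l) = fst l"
  by (cases l; simp)+

fun src :: "letter \<Rightarrow> snowflake_gen" where
  "src (Gs, True) = Gx"
| "src (Gt, True) = Gy"
| "src _ = Ga"

abbreviation tgt :: "letter \<Rightarrow> snowflake_gen" where "tgt l \<equiv> src (inv_letter l)"

fun lift :: "snowflake_gen \<Rightarrow> int \<Rightarrow> int \<times> int" where
  "lift Ga q = (0, q)"
| "lift _ q = (q, 0)"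

fun coeff :: "snowflake_gen \<Rightarrow> int \<times> int \<Rightarrow> int" where
  "coeff Gx h = snd h"
| "coeff Gy h = - snd h"
| "coeff _ h = fst h"

definition sgn_of :: "bool \<Rightarrow> int" where "sgn_of b = (if b then 1 else - 1)"

fun reduced :: "stack \<Rightarrow> bool" where
  "reduced [] = True"
| "reduced [(q, l)] = (fst l \<in> {Gs, Gt})"
| "reduced ((q, l) # (q', l') # stk) =
    (fst l \<in> {Gs, Gt} \<and> \<not> (l' = inv_letter l \<and> q = 0) \<and> reduced ((q', l') # stk))"

lemma reduced_Cons: "reduced (c # stk) \<longleftrightarrow> fst (snd c) \<in> {Gs, Gt} \<and> reduced stk \<and>
    \<not> (stk \<noteq> [] \<and> snd (hd stk) = inv_letter (snd c) \<and> fst c = 0)"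
  by (cases c; cases stk) auto

context snowflake
begin

text \<open>With \<open>lift\<close> and \<open>coeff\<close> this splits an element into a coset
  representative and a power of \<open>d\<close>. The term with \<open>L\<close>, like the sign in
  \<open>coeff Gy\<close>, comes from \<open>y = a^L x^{-1}\<close>.\<close>

fun quo :: "snowflake_gen \<Rightarrow> int \<times> int \<Rightarrow> int" where
  "quo Gx h = fst h"
| "quo Gy h = fst h + int L * snd h"
| "quo _ h = snd h"

lemma src_cases: "src l \<in> {Ga, Gx, Gy}"
  by (cases l rule: src.cases) auto

lemma lift_quo: "d \<in> {Ga, Gx, Gy} \<Longrightarrow> lift d (quo d h) + vec d (coeff d h) = h"
  by (cases h) auto

lemma quo_add: "d \<in> {Ga, Gx, Gy} \<Longrightarrow> quo d (h + vec d k) = quo d h"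
  by (cases h) (auto simp: algebra_simps)

lemma coeff_add: "d \<in> {Ga, Gx, Gy} \<Longrightarrow> coeff d (h + vec d k) = coeff d h + k"
  by (cases h) auto

lemma quo_vec: "d \<in> {Ga, Gx, Gy} \<Longrightarrow> quo d (vec d k) = 0"
  by auto

lemma coeff_vec: "d \<in> {Ga, Gx, Gy} \<Longrightarrow> coeff d (vec d k) = k"
  by auto

lemma quo_lift: "d \<in> {Ga, Gx, Gy} \<Longrightarrow> quo d (lift d q) = q"
  by auto

lemma coeff_lift: "d \<in> {Ga, Gx, Gy} \<Longrightarrow> coeff d (lift d q) = 0"
  by auto

lemma vec_coeff: "quo (src l) h = 0 \<Longrightarrow> vec (src l) (coeff (src l) h) = h"
  using src_cases[of l] by (cases h) auto

lemmas quo_coeff [simp] = quo_add[OF src_cases] coeff_add[OF src_cases] quo_vec[OF src_cases]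
  coeff_vec[OF src_cases] quo_lift[OF src_cases] coeff_lift[OF src_cases]

definition pops :: "letter \<Rightarrow> stack \<Rightarrow> int \<times> int \<Rightarrow> bool" where
  "pops l stk h \<longleftrightarrow> stk \<noteq> [] \<and> snd (hd stk) = inv_letter l \<and> quo (src l) h = 0"

text \<open>Right multiplication by \<open>l\<close>: a pinch is removed and the representative
  stored with it is multiplied back in; otherwise the representative of \<open>h\<close> is
  stored.\<close>

definition cross :: "letter \<Rightarrow> stack \<times> int \<times> int \<Rightarrow> stack \<times> int \<times> int" where
  "cross l = (\<lambda>(stk, h).
     if pops l stk h then (tl stk, lift (tgt l) (fst (hd stk)) + vec (tgt l) (coeff (src l) h))
     else ((quo (src l) h, l) # stk, vec (tgt l) (coeff (src l) h)))"

definition act :: "letter \<Rightarrow> stack \<times> int \<times> int \<Rightarrow> stack \<times> int \<times> int" where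
  "act l st = (if fst l \<in> {Gs, Gt} then cross l st
     else (fst st, snd st + vec (fst l) (sgn_of (snd l))))"

lemma act_simps [simp]:
  "z \<in> {Ga, Gx, Gy} \<Longrightarrow> act (z, b) (stk, h) = (stk, h + vec z (sgn_of b))"
  "e \<in> {Gs, Gt} \<Longrightarrow> act (e, b) (stk, h) = cross (e, b) (stk, h)"
  by (auto simp: act_def)

lemma cross_add:
  "cross l (stk, h + vec (src l) k) = apsnd (\<lambda>h. h + vec (tgt l) k) (cross l (stk, h))"
  using src_cases[of l] by (auto simp: cross_def pops_def vec_add add.assoc)

text \<open>After a pop, reducedness keeps the inverse crossing from popping again, so it restores
  the entry just removed.\<close>

lemma cross_inv:
  assumes "reduced (fst st)" "fst l \<in> {Gs, Gt}"
  shows "cross (inv_letter l) (cross l st) = st"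
proof -
  obtain stk h where Pair: "st = (stk, h)" by (rule prod.exhaust)
  show ?thesis
  proof (cases "pops l stk h")
    case False
    then have "cross l st = ((quo (src l) h, l) # stk, vec (tgt l) (coeff (src l) h))"
      using Pair by (simp add: cross_def)
    then show ?thesis
      using Pair lift_quo[OF src_cases] by (simp add: cross_def pops_def)
  next
    case True
    then obtain q rest where stk: "stk = (q, inv_letter l) # rest" and q: "quo (src l) h = 0"
      by (cases stk) (auto simp: pops_def)
    have h: "vec (src l) (coeff (src l) h) = h"
      using q by (rule vec_coeff)
    have "\<not> (rest \<noteq> [] \<and> snd (hd rest) = l \<and> q = 0)"
      using assms(1) Pair stk by (simp add: reduced_Cons)
    then have "\<not> pops (inv_letter l) rest (lift (tgt l) q + vec (tgt l) (coeff (src l) h))"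
      by (simp add: pops_def)
    then show ?thesis
      using Pair True stk h by (simp add: cross_def)
  qed
qed

lemma act_inv: "reduced (fst st) \<Longrightarrow> act (inv_letter l) (act l st) = st"
  by (cases l; cases st)
    (auto simp: act_def sgn_of_def vec_minus cross_inv[of _ "(_, _)", simplified])

lemma reduced_act: "reduced (fst st) \<Longrightarrow> reduced (fst (act l st))"
  by (cases st; cases "fst st")
    (auto simp: act_def cross_def pops_def reduced_Cons)

section \<open>The action of words on reduced states\<close>

abbreviation acts :: "snowflake_gen word \<Rightarrow> stack \<times> int \<times> int \<Rightarrow> stack \<times> int \<times> int" where
  "acts w \<equiv> fold act w"

lemma reduced_acts: "reduced (fst st) \<Longrightarrow> reduced (fst (acts w st))"
  by (induction w arbitrary: st) (auto simp: reduced_act)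

lemma acts_conj:
  assumes "reduced (fst st)" "e \<in> {Gs, Gt}"
  shows "acts [pos e, pos Ga, neg e] st = act (pos (src (pos e))) st"
proof -
  have "act (pos Ga) (act (pos e) st) = act (pos e) (act (pos (src (pos e))) st)"
    using assms cross_add[of "pos e" "fst st" "snd st" 1] by (auto simp: act_def sgn_of_def apsnd_def map_prod_def split: prod.splits)
  then show ?thesis
    using act_inv[OF reduced_act[OF assms(1)], of "pos e" "pos (src (pos e))"] by simp
qed

lemma acts_relation:
  assumes "(l, r) \<in> snowflake_relations L" "reduced (fst st)"
  shows "acts l st = acts r st"
proof -
  have a: "(act (pos Ga) ^^ n) (s, i, j) = (s, i + int n, j)" for n s i j
    by (induction n) (auto simp: act_def sgn_of_def add.assoc)
  show ?thesis
    using assms acts_conj[OF assms(2), of Gs] acts_conj[OF assms(2), of Gt]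
    by (cases st) (auto simp: snowflake_relations_def a act_def sgn_of_def)
qed

text \<open>The relations hold as identities between maps of reduced states, so the state reached
  depends only on the group element.\<close>

lemma acts_word_eq:
  "word_eq (snowflake_relations L) u v \<Longrightarrow> reduced (fst st) \<Longrightarrow> acts u st = acts v st"
proof (induction arbitrary: st rule: word_eq.induct)
  case (cancel u z b v)
  then show ?case using act_inv[OF reduced_acts[OF cancel], of "(z, b)" u] by simp
next
  case (relation l r u v)
  then show ?case using acts_relation[OF relation(1) reduced_acts[OF relation(2)]] by simp
qed auto

text \<open>\<open>F stk h\<close> is the cost of the cheapest path from the identity that crosses the letters of \<open>stk\<close> in
  order, passing over each at some element of the associated coset.\<close>

primrec F :: "stack \<Rightarrow> int \<times> int \<Rightarrow> nat" where
  "F [] = \<nu>"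
| "F (c # stk) = (\<lambda>h. INF k. F stk (lift (src (snd c)) (fst c) + vec (src (snd c)) k) + 1
     + \<nu> (h - vec (tgt (snd c)) k))"

declare F.simps(2) [simp del]

lemma F_le: "F ((q, l) # stk) h \<le> F stk (lift (src l) q + vec (src l) k) + 1 + \<nu> (h - vec (tgt l) k)"
  unfolding F.simps by (rule order_trans[OF INF_nat_le[where r = k]]) simp

lemma F_attained:
  obtains k where "F ((q, l) # stk) h = F stk (lift (src l) q + vec (src l) k) + 1 + \<nu> (h - vec (tgt l) k)"
  unfolding F.simps by (rule INF_nat_attained[of "\<lambda>k. F stk (lift (src (snd (q, l))) (fst (q, l))
    + vec (src (snd (q, l))) k) + 1 + \<nu> (h - vec (tgt (snd (q, l))) k)"]) auto

lemma F_add: "F stk (h + h') \<le> F stk h + \<nu> h'"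
proof (cases stk)
  case Nil
  then show ?thesis by (simp add: \<nu>_add)
next
  case (Cons c stk')
  obtain q l where c: "c = (q, l)" by (rule prod.exhaust)
  obtain k where k: "F ((q, l) # stk') h
      = F stk' (lift (src l) q + vec (src l) k) + 1 + \<nu> (h - vec (tgt l) k)"
    by (rule F_attained)
  have "\<nu> (h + h' - vec (tgt l) k) \<le> \<nu> (h - vec (tgt l) k) + \<nu> h'"
    using \<nu>_add[of "h - vec (tgt l) k" h'] by (simp add: algebra_simps)
  then show ?thesis
    using F_le[of q l stk' "h + h'" k] k Cons c by simp
qed

lemma \<nu>_src_tgt: "\<nu> (vec (tgt l) k) \<le> \<nu> (vec (src l) k) + 2"
  using f_le_g[of k] g_le_f[of k]
  by (cases l rule: src.cases; cases "fst l") (auto simp: \<nu>_vec \<nu>_a simp del: vec.simps)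

definition \<Phi> :: "stack \<times> int \<times> int \<Rightarrow> nat" where "\<Phi> st = F (fst st) (snd st)"

text \<open>For a push, take \<open>k = coeff (src l) h\<close>. For a pop, the path counted by
  \<open>F\<close> crosses the removed letter at some \<open>k\<close>; staying in the old coset
  saves this crossing and replaces a power of \<open>src l\<close> by the same power of
  \<open>tgt l\<close>, which is longer by at most 2.\<close>

lemma \<Phi>_cross: "\<Phi> (cross l st) \<le> \<Phi> st + 1"
proof -
  obtain stk h where Pair: "st = (stk, h)" by (rule prod.exhaust)
  show ?thesis
  proof (cases "pops l stk h")
    case False
    then show ?thesis
      using Pair F_le[of "quo (src l) h" l stk "vec (tgt l) (coeff (src l) h)" "coeff (src l) h"]
        lift_quo[OF src_cases, of l h] by (simp add: cross_def \<Phi>_def)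
  next
    case True
    then obtain q rest where stk: "stk = (q, inv_letter l) # rest" and q: "quo (src l) h = 0"
      by (cases stk) (auto simp: pops_def)
    have h: "vec (src l) (coeff (src l) h) = h"
      using q by (rule vec_coeff)
    define c where "c = coeff (src l) h"
    obtain k where k: "F ((q, inv_letter l) # rest) h
        = F rest (lift (tgt l) q + vec (tgt l) k) + 1 + \<nu> (h - vec (src l) k)"
      using F_attained[of q "inv_letter l" rest h] by auto
    have "F rest (lift (tgt l) q + vec (tgt l) c)
        \<le> F rest (lift (tgt l) q + vec (tgt l) k) + \<nu> (vec (tgt l) (c - k))"
      using F_add[of rest "lift (tgt l) q + vec (tgt l) k" "vec (tgt l) (c - k)"]
      by (simp add: vec_diff)
    also have "\<nu> (vec (tgt l) (c - k)) \<le> \<nu> (h - vec (src l) k) + 2"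
      using \<nu>_src_tgt[of l "c - k"] h by (simp add: vec_diff c_def)
    finally show ?thesis
      using Pair True stk k by (simp add: cross_def \<Phi>_def c_def)
  qed
qed

lemma \<nu>_unit: "d \<in> {Ga, Gx, Gy} \<Longrightarrow> real (\<nu> (vec d (sgn_of b))) \<le> snowflake_len L d"
  using f_le_abs[of "sgn_of b"] g_le_f[of "sgn_of b"] L_ge
  by (auto simp: \<nu>_vec \<nu>_a sgn_of_def simp del: vec.simps)

lemma \<Phi>_act: "real (\<Phi> (act l st)) \<le> real (\<Phi> st) + snowflake_len L (fst l)"
proof (cases "fst l \<in> {Gs, Gt}")
  case True
  then show ?thesis using \<Phi>_cross[of l st] by (auto simp: act_def)
next
  case False
  then have "fst l \<in> {Ga, Gx, Gy}" using snowflake_gen.exhaust by blast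
  then show ?thesis
    using F_add[of "fst st" "snd st" "vec (fst l) (sgn_of (snd l))"] \<nu>_unit[of "fst l" "snd l"] False
    by (simp add: act_def \<Phi>_def)
qed

end

section \<open>Positive words\<close>

definition inv_word :: "snowflake_gen word \<Rightarrow> snowflake_gen word" where
  "inv_word w = rev (map inv_letter w)"

lemma inv_word_simps [simp]:
  "inv_word [] = []"
  "inv_word (l # p) = inv_word p @ [inv_letter l]"
  "inv_word (p @ q) = inv_word q @ inv_word p"
  "inv_word (replicate n l) = replicate n (inv_letter l)"
  "inv_word (inv_word p) = p"
  by (simp_all add: inv_word_def rev_map comp_def map_idI)

definition positive :: "snowflake_gen word \<Rightarrow> bool" where
  "positive p \<longleftrightarrow> neg Gs \<notin> set p \<and> neg Gt \<notin> set p"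

lemma positive_simps [simp]:
  "positive []"
  "positive (l # p) \<longleftrightarrow> l \<noteq> neg Gs \<and> l \<noteq> neg Gt \<and> positive p"
  "positive (p @ q) \<longleftrightarrow> positive p \<and> positive q"
  by (auto simp: positive_def)

context snowflake
begin

text \<open>\<open>D p h\<close> bounds the distance from \<open>p\<close> to the element \<open>h\<close> of the vertex group: it is the bound
  for the length of \<open>p\<inverse> h\<close>.\<close>

definition D :: "snowflake_gen word \<Rightarrow> int \<times> int \<Rightarrow> nat" where
  "D p h = (let st = acts (inv_word p) ([], 0) in F (fst st) (snd st + h))"

lemma D_Nil [simp]: "D [] h = \<nu> h"
  by (simp add: D_def)

lemma D_add: "D p (h + h') \<le> D p h + \<nu> h'"
  unfolding D_def Let_def by (subst add.assoc[symmetric]) (rule F_add)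

lemma D_H: "z \<in> {Ga, Gx, Gy} \<Longrightarrow> D ((z, b) # p) h = D p (h - vec z (sgn_of b))"
  by (cases "acts (inv_word p) ([], 0)")
    (simp add: D_def Let_def sgn_of_def vec_minus algebra_simps)

lemma D_replicate:
  "z \<in> {Ga, Gx, Gy} \<Longrightarrow> D (replicate m (z, b) @ p) h = D p (h - vec z (sgn_of b * int m))"
proof (induction m arbitrary: h)
  case (Suc m)
  have "h - vec z (sgn_of b) - vec z (sgn_of b * int m) = h - vec z (sgn_of b * int (Suc m))"
    by (simp add: distrib_left vec_add)
  with D_H[OF Suc.prems, of b "replicate m (z, b) @ p" h] Suc show ?case
    unfolding replicate_Suc append_Cons by metis
qed simp

text \<open>\<open>inv_word p\<close> crosses only negative letters, and only crossed letters are
  pushed. Hence a further \<open>neg e\<close> never pops, which gives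
  \<open>acts_inv_pos\<close>.\<close>

lemma negative_stack:
  "positive p \<Longrightarrow> \<forall>c\<in>set (fst (acts (inv_word p) ([], 0))). \<not> snd (snd c)"
proof (induction p)
  case (Cons l p)
  obtain z b where l: "l = (z, b)" by (rule prod.exhaust)
  obtain stk h where st: "acts (inv_word p) ([], 0) = (stk, h)" by (rule prod.exhaust)
  have "z \<in> {Gs, Gt} \<or> z \<in> {Ga, Gx, Gy}" by (cases z) auto
  moreover have "set (tl stk) \<subseteq> set stk" by (cases stk) auto
  ultimately have "c \<in> set stk \<or> z \<in> {Gs, Gt} \<and> snd c = inv_letter l"
    if "c \<in> set (fst (act (inv_letter l) (stk, h)))" for c
    using that l by (auto simp: cross_def split: if_splits)
  with Cons l st show ?case by fastforce
qed simp

lemma acts_inv_pos: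
  assumes "positive p" "e \<in> {Gs, Gt}"
  defines "st \<equiv> acts (inv_word p) ([], 0)"
  shows "acts (inv_word (pos e # p)) ([], 0)
    = ((snd (snd st), neg e) # fst st, vec (src (pos e)) (fst (snd st)))"
proof -
  have "fst st \<noteq> [] \<Longrightarrow> hd (fst st) \<in> set (fst st)" by simp
  then have "\<not> pops (neg e) (fst st) (snd st)"
    using negative_stack[OF assms(1)] unfolding st_def pops_def by fastforce
  then show ?thesis
    using assms(2) by (cases st) (auto simp: act_def cross_def st_def)
qed

lemma D_pos_aux:
  assumes "positive p" "e \<in> {Gs, Gt}"
  obtains stk q c where
    "\<And>h. D (pos e # p) h = F ((q, neg e) # stk) (vec (src (pos e)) c + h)"
    "\<And>h. D p h = F stk (lift Ga q + vec Ga c + h)"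
proof -
  define st where "st = acts (inv_word p) ([], 0)"
  show ?thesis
    by (rule that[of "snd (snd st)" "fst st" "fst (snd st)"])
      (use acts_inv_pos[OF assms] in \<open>simp_all add: D_def Let_def st_def\<close>)
qed

text \<open>With \<open>D_pos_attained\<close> this makes \<open>D (pos e # p) h\<close> a minimum
  over the places where a path from \<open>e p\<close> to \<open>h\<close> can pass the letter
  \<open>e\<close>: \<open>e a^k = z^k e\<close> with \<open>z = src (pos e)\<close>.\<close>

lemma D_pos_le:
  assumes "positive p" "e \<in> {Gs, Gt}"
  shows "D (pos e # p) h \<le> D p (vec Ga k) + 1 + \<nu> (h - vec (src (pos e)) k)"
proof -
  obtain stk q c where *: "\<And>h. D (pos e # p) h = F ((q, neg e) # stk) (vec (src (pos e)) c + h)"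
    "\<And>h. D p h = F stk (lift Ga q + vec Ga c + h)" by (rule D_pos_aux[OF assms]) (rule that)
  have "src (neg e) = Ga" by (cases e) auto
  moreover have "vec (src (pos e)) c + h - vec (src (pos e)) (c + k) = h - vec (src (pos e)) k"
    by (simp add: vec_add)
  moreover have "lift Ga q + vec Ga (c + k) = lift Ga q + vec Ga c + vec Ga k"
    by (simp only: vec_add add.assoc)
  ultimately show ?thesis
    using F_le[of q "neg e" stk "vec (src (pos e)) c + h" "c + k"]
    unfolding * by (metis inv_letter.simps not_False_eq_True)
qed

lemma D_pos_attained:
  assumes "positive p" "e \<in> {Gs, Gt}"
  obtains k where "D (pos e # p) h = D p (vec Ga k) + 1 + \<nu> (h - vec (src (pos e)) k)"
proof -
  obtain stk q c where *: "\<And>h. D (pos e # p) h = F ((q, neg e) # stk) (vec (src (pos e)) c + h)"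
    "\<And>h. D p h = F stk (lift Ga q + vec Ga c + h)" by (rule D_pos_aux[OF assms]) (rule that)
  have s: "src (neg e) = Ga" by (cases e) auto
  obtain k where k: "F ((q, neg e) # stk) (vec (src (pos e)) c + h) = F stk (lift Ga q + vec Ga k)
      + 1 + \<nu> (vec (src (pos e)) c + h - vec (src (pos e)) k)"
    using F_attained[of q "neg e" stk "vec (src (pos e)) c + h"] s by (metis inv_letter.simps not_False_eq_True)
  have "vec (src (pos e)) c + h - vec (src (pos e)) k = h - vec (src (pos e)) (k - c)"
    by (simp add: vec_diff)
  moreover have "lift Ga q + vec Ga k = lift Ga q + vec Ga c + vec Ga (k - c)"
    by (simp add: vec_diff del: vec.simps lift.simps)
  ultimately show ?thesis
    using that[of "k - c"] k unfolding * by metis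
qed

text \<open>Here \<open>k\<close> tells at which element of the coset the path passes
  \<open>e\<close>. The bound for \<open>p\<close> is an assumption, as the lemma serves both the
  induction in \<open>\<Phi>_positive\<close> and \<open>\<Phi>_antipode\<close>.\<close>

lemma \<Phi>_push:
  assumes "positive p" "e \<in> {Gs, Gt}" "\<not> pops (pos e) stk h"
    and IH: "\<And>q h. \<exists>h'. F ((q, pos e) # stk) (h + h') + D p h' \<le> \<Phi> (acts p ((q, pos e) # stk, h))"
  shows "\<exists>k. F stk (h + vec (src (pos e)) k) + 1 + D p (vec Ga k) \<le> \<Phi> (acts (pos e # p) (stk, h))"
proof -
  let ?z = "src (pos e)"
  have a: "src (neg e) = Ga" by (cases e) auto
  define c where "c = coeff ?z h"
  have act: "act (pos e) (stk, h) = ((quo ?z h, pos e) # stk, vec Ga c)"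
    using assms by (auto simp: cross_def c_def a simp del: vec.simps)
  obtain h' where h': "F ((quo ?z h, pos e) # stk) (vec Ga c + h') + D p h'
      \<le> \<Phi> (acts p ((quo ?z h, pos e) # stk, vec Ga c))"
    using IH by blast
  obtain k where k: "F ((quo ?z h, pos e) # stk) (vec Ga c + h')
      = F stk (lift ?z (quo ?z h) + vec ?z k) + 1 + \<nu> (vec Ga c + h' - vec Ga k)"
    using F_attained[of "quo ?z h" "pos e" stk "vec Ga c + h'"] a by (metis inv_letter.simps not_True_eq_False)
  have "D p (vec Ga (k - c)) \<le> D p h' + \<nu> (vec Ga c + h' - vec Ga k)"
    using D_add[of p h' "- (vec Ga c + h' - vec Ga k)"] \<nu>_minus[of "vec Ga c + h' - vec Ga k"]
    by (simp add: vec_diff algebra_simps del: vec.simps)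
  moreover have "h + vec ?z (k - c) = lift ?z (quo ?z h) + vec ?z k"
    using lift_quo[OF src_cases, of "pos e" h] unfolding c_def vec_diff by (simp add: algebra_simps)
  ultimately show ?thesis
    using h' k act by (intro exI[of _ "k - c"]) simp
qed

text \<open>A positive word on a stack with no negative top only pushes. So a path counted by
  \<open>\<Phi>\<close> visits the starting coset, at \<open>h + h'\<close>, and the rest of it
  costs at least \<open>D p h'\<close>.\<close>

lemma \<Phi>_positive:
  assumes "positive p" "stk = [] \<or> snd (snd (hd stk))"
  shows "\<exists>h'. F stk (h + h') + D p h' \<le> \<Phi> (acts p (stk, h))"
  using assms
proof (induction p arbitrary: stk h)
  case Nil
  then show ?case by (intro exI[of _ 0]) (simp add: \<Phi>_def)
next
  case (Cons l p)
  obtain z b where l: "l = (z, b)" by (rule prod.exhaust)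
  show ?case
  proof (cases "z \<in> {Gs, Gt}")
    case True
    then have b: "l = pos z" using Cons.prems l by auto
    have "\<not> pops (pos z) stk h" using Cons.prems by (auto simp: pops_def)
    moreover have "\<exists>h'. F ((q, pos z) # stk) (h + h') + D p h' \<le> \<Phi> (acts p ((q, pos z) # stk, h))" for q h
      by (rule Cons.IH) (use Cons.prems in simp_all)
    ultimately obtain k where k: "F stk (h + vec (src (pos z)) k) + 1 + D p (vec Ga k) \<le> \<Phi> (acts (l # p) (stk, h))"
      using \<Phi>_push[of p z stk h] Cons.prems(1) True unfolding b by fastforce
    have "D (l # p) (vec (src (pos z)) k) \<le> D p (vec Ga k) + 1"
      using D_pos_le[of p z "vec (src (pos z)) k" k] Cons.prems True b by simp
    with k show ?thesis by (intro exI[of _ "vec (src (pos z)) k"]) simp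
  next
    case False
    then have z: "z \<in> {Ga, Gx, Gy}" using snowflake_gen.exhaust by blast
    have "positive p" using Cons.prems(1) by simp
    then obtain h' where h': "F stk (h + vec z (sgn_of b) + h') + D p h' \<le> \<Phi> (acts p (stk, h + vec z (sgn_of b)))"
      using Cons.IH[of stk "h + vec z (sgn_of b)"] Cons.prems(2) by blast
    then show ?thesis
      using False l by (intro exI[of _ "vec z (sgn_of b) + h'"]) (use z in \<open>simp add: D_H[OF z] add.assoc\<close>)
  qed
qed

lemma acts_replicate:
  "z \<in> {Ga, Gx, Gy} \<Longrightarrow> acts (replicate n (z, b)) (stk, h) = (stk, h + vec z (sgn_of b * int n))"
proof (induction n arbitrary: h)
  case (Suc n)
  from Suc.IH[OF Suc.prems] Suc.prems show ?case
    by (simp add: distrib_left vec_add add.assoc add.commute[of "vec z (sgn_of b)"] del: fold_replicate)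
qed simp

definition other :: "snowflake_gen \<Rightarrow> snowflake_gen" where
  "other e = (if e = Gs then Gt else Gs)"

text \<open>A path crosses the two letters \<open>e\<close> at exponents \<open>j\<close> and
  \<open>k\<close>. In between it pays \<open>g (k - j) + g m\<close> by \<open>\<nu>_xy\<close>;
  the first summand moves the target of \<open>p\<close> from \<open>a^j\<close> to
  \<open>a^k\<close>, where \<open>c\<close> applies.\<close>

lemma \<Phi>_antipode:
  assumes p: "positive p" "positive p'" and e: "e \<in> {Gs, Gt}" and n: "n \<noteq> 0"
    and c: "\<And>k. c \<le> D p (vec Ga k) + D p' (vec Ga k)"
  shows "c + 2 + g (int n) \<le>
    \<Phi> (acts (inv_word (pos e # p) @ replicate n (src (pos (other e)), b) @ pos e # p') ([], 0))"
proof -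
  let ?z = "src (pos e)" and ?z' = "src (pos (other e))"
  define m where "m = sgn_of b * int n"
  have m: "m \<noteq> 0" "g m = g (int n)" using n by (auto simp: m_def sgn_of_def)
  have zz: "(?z, ?z') = (Gx, Gy) \<or> (?z, ?z') = (Gy, Gx)"
    using e by (auto simp: other_def)
  then have z': "?z' \<in> {Ga, Gx, Gy}" by auto
  obtain stk h where st: "acts (inv_word (pos e # p)) ([], 0) = (stk, h)" by (rule prod.exhaust)
  have D: "D (pos e # p) h' = F stk (h + h')" for h' by (simp only: D_def Let_def st fst_conv snd_conv)
  have h: "h = vec ?z (coeff ?z h)"
    using acts_inv_pos[OF p(1) e] st by auto
  \<comment> \<open>A nonzero power of \<open>?z'\<close> lies outside the cyclic group of
    \<open>?z\<close>, so the second \<open>e\<close> does not cancel the first.\<close>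
  have "quo ?z (h + vec ?z' m) \<noteq> 0"
    using zz m(1) L_ge by (subst h) auto
  then have np: "\<not> pops (pos e) stk (h + vec ?z' m)" by (simp add: pops_def)
  have "\<exists>k. F stk (h + vec ?z' m + vec ?z k) + 1 + D p' (vec Ga k)
      \<le> \<Phi> (acts (pos e # p') (stk, h + vec ?z' m))"
    by (rule \<Phi>_push[OF p(2) e np]) (rule \<Phi>_positive[OF p(2)], simp)
  then obtain k where k: "D (pos e # p) (vec ?z' m + vec ?z k) + 1 + D p' (vec Ga k)
      \<le> \<Phi> (acts (pos e # p') (stk, h + vec ?z' m))"
    by (auto simp: D add.assoc)
  obtain j where j: "D (pos e # p) (vec ?z' m + vec ?z k)
      = D p (vec Ga j) + 1 + \<nu> (vec ?z' m + vec ?z k - vec ?z j)"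
    using D_pos_attained[OF p(1) e] by blast
  have "vec ?z' m + vec ?z k - vec ?z j = vec ?z (k - j) + vec ?z' m"
    by (simp add: vec_diff algebra_simps)
  then have "g (k - j) + g m \<le> \<nu> (vec ?z' m + vec ?z k - vec ?z j)"
    using \<nu>_xy[OF zz, of "k - j" m] by (simp only:)
  moreover have "D p (vec Ga k) \<le> D p (vec Ga j) + g (k - j)"
    using D_add[of p "vec Ga j" "vec Ga (k - j)"] f_le_g[of "k - j"] \<nu>_a[of "k - j"]
    by (simp flip: vec_add del: vec.simps)
  moreover have "acts (inv_word (pos e # p) @ replicate n (?z', b) @ pos e # p') ([], 0)
      = acts (pos e # p') (stk, h + vec ?z' m)"
    using acts_replicate[OF z', of n b stk h] st by (simp add: m_def del: fold_replicate)
  ultimately show ?thesis using k j c[of k] m by simp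
qed

end

section \<open>The snowflake loops\<close>

context snowflake
begin

abbreviation weq :: "snowflake_gen word \<Rightarrow> snowflake_gen word \<Rightarrow> bool" where
  "weq \<equiv> word_eq (snowflake_relations L)"

lemmas weq_trans [trans] = word_eq.trans[of "snowflake_relations L"]

lemmas weq_append = word_eq_append[of "snowflake_relations L"]

lemma weq_relation: "(l, r) \<in> snowflake_relations L \<Longrightarrow> weq l r"
  using word_eq.relation[of l r "snowflake_relations L" "[]" "[]"] by simp

lemma weq_inv_left: "weq (inv_word u @ u) []"
proof -
  have "inv_letter = (\<lambda>(g, b). (g, \<not> b))" by auto
  then have "inv_word u = rev (map (\<lambda>(g, b). (g, \<not> b)) u)" unfolding inv_word_def by metis
  then show ?thesis using word_eq_inverse[of _ u] by metis
qed

lemma weq_inv_right: "weq (u @ inv_word u) []"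
  using weq_inv_left[of "inv_word u"] by simp

lemma weq_cancel_mid: "weq w [] \<Longrightarrow> weq (u @ w @ v) (u @ v)"
  using word_eq_context[of "snowflake_relations L" w "[]" u v] by simp

lemma weq_inv: assumes "weq u v" shows "weq (inv_word u) (inv_word v)"
proof -
  have "weq (inv_word u) (inv_word u @ v @ inv_word v)"
    using weq_cancel_mid[OF weq_inv_right[of v], of "inv_word u" "[]"] by (simp add: word_eq.sym)
  also have "weq \<dots> (inv_word u @ u @ inv_word v)"
    by (rule word_eq_context[OF word_eq.sym[OF assms]])
  also have "weq \<dots> (inv_word v)"
    using weq_cancel_mid[OF weq_inv_left[of u], of "[]" "inv_word v"] by simp
  finally show ?thesis .
qed

lemma weq_conj_power:
  assumes "e \<in> {Gs, Gt}"
  shows "weq (pos e # replicate n (pos Ga) @ [neg e]) (replicate n (pos (src (pos e))))"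
proof (induction n)
  case 0
  show ?case using word_eq.cancel[of _ "[]" e True "[]"] by simp
next
  case (Suc n)
  have "weq (pos e # replicate (Suc n) (pos Ga) @ [neg e])
      ([pos e, pos Ga, neg e] @ pos e # replicate n (pos Ga) @ [neg e])"
    using word_eq.sym[OF word_eq.cancel[of "snowflake_relations L" "[pos e, pos Ga]" e False "replicate n (pos Ga) @ [neg e]"]]
    by simp
  also have "weq \<dots> ([pos (src (pos e))] @ replicate n (pos (src (pos e))))"
    by (rule weq_append[OF weq_relation Suc]) (use assms in \<open>auto simp: snowflake_relations_def\<close>)
  finally show ?case by simp
qed

lemma weq_xy: "weq [pos Gx, pos Gy] [pos Gy, pos Gx]"
proof -
  have "weq [pos Gx, pos Gy] ([pos Gx, pos Gy] @ [neg Gx, pos Gx] @ [])"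
    using word_eq.sym[OF word_eq.cancel[of _ "[pos Gx, pos Gy]" Gx False "[]"]] by simp
  also have "weq \<dots> ([pos Gx, pos Gy, neg Gx] @ [neg Gy, pos Gy] @ [pos Gx])"
    using word_eq.sym[OF word_eq.cancel[of _ "[pos Gx, pos Gy, neg Gx]" Gy False "[pos Gx]"]] by simp
  also have "weq \<dots> ([] @ [] @ [pos Gy, pos Gx])"
    using word_eq.relation[of "commutator Gx Gy" "[]" "snowflake_relations L" "[]" "[pos Gy, pos Gx]"]
    by (simp add: snowflake_relations_def)
  finally show ?thesis by simp
qed

lemma weq_commute_power:
  assumes "weq [l, l'] [l', l]"
  shows "weq (replicate m l @ replicate n l') (replicate n l' @ replicate m l)"
proof -
  have one: "weq (replicate m l @ [l']) (l' # replicate m l)" for m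
  proof (induction m)
    case (Suc m)
    have "weq ([l] @ replicate m l @ [l']) ([l] @ l' # replicate m l)"
      by (rule weq_append[OF word_eq.refl Suc])
    also have "weq \<dots> ([l', l] @ replicate m l)"
      using weq_append[OF assms word_eq.refl] by simp
    finally show ?case by simp
  qed (simp add: word_eq.refl)
  show ?thesis
  proof (induction n)
    case (Suc n)
    have "weq (replicate m l @ replicate (Suc n) l') ([l'] @ replicate m l @ replicate n l')"
      using weq_append[OF one word_eq.refl, of m "replicate n l'"] by simp
    also have "weq ([l'] @ replicate m l @ replicate n l') ([l'] @ replicate n l' @ replicate m l)"
      by (rule weq_append[OF word_eq.refl Suc])
    finally show ?case by simp
  qed (simp add: word_eq.refl)
qed

lemma weq_L_power: "weq (replicate m (pos Gx) @ replicate m (pos Gy)) (replicate (L * m) (pos Ga))"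
proof (induction m)
  case (Suc m)
  have "weq ([pos Gx] @ (replicate m (pos Gx) @ replicate 1 (pos Gy)) @ replicate m (pos Gy))
      ([pos Gx] @ (replicate 1 (pos Gy) @ replicate m (pos Gx)) @ replicate m (pos Gy))"
    by (intro weq_append word_eq.refl weq_commute_power weq_xy)
  then have "weq (replicate (Suc m) (pos Gx) @ replicate (Suc m) (pos Gy))
      ([pos Gx, pos Gy] @ replicate m (pos Gx) @ replicate m (pos Gy))"
    by simp
  also have "weq ([pos Gx, pos Gy] @ replicate m (pos Gx) @ replicate m (pos Gy))
      (replicate L (pos Ga) @ replicate (L * m) (pos Ga))"
    by (rule weq_append[OF word_eq.sym[OF weq_relation] Suc]) (simp add: snowflake_relations_def)
  finally show ?case by (simp add: replicate_add)
qed (simp add: word_eq.refl)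

section \<open>Snowflake words and their prefixes\<close>

fun snow :: "nat \<Rightarrow> snowflake_gen word" where
  "snow 0 = [pos Ga]"
| "snow (Suc k) = (pos Gs # snow k @ [neg Gs]) @ pos Gt # snow k @ [neg Gt]"

definition side :: "snowflake_gen \<Rightarrow> nat \<Rightarrow> snowflake_gen word" where
  "side e k = pos e # snow k @ [neg e]"

lemma weq_side_aux:
  assumes "weq (snow k) (replicate n (pos Ga))" "e \<in> {Gs, Gt}"
  shows "weq (side e k) (replicate n (pos (src (pos e))))"
proof -
  have "weq ([pos e] @ snow k @ [neg e]) ([pos e] @ replicate n (pos Ga) @ [neg e])"
    by (rule word_eq_context[OF assms(1)])
  also have "weq \<dots> (replicate n (pos (src (pos e))))"
    using weq_conj_power[OF assms(2)] by simp
  finally show ?thesis by (simp add: side_def)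
qed

lemma weq_snow: "weq (snow k) (replicate (L ^ k) (pos Ga))"
proof (induction k)
  case (Suc k)
  have "weq (side Gs k @ side Gt k) (replicate (L ^ k) (pos Gx) @ replicate (L ^ k) (pos Gy))"
    using weq_side_aux[OF Suc, of Gs] weq_side_aux[OF Suc, of Gt] by (intro weq_append) simp_all
  also have "weq \<dots> (replicate (L ^ Suc k) (pos Ga))"
    using weq_L_power[of "L ^ k"] by simp
  finally show ?case by (simp add: side_def)
qed (simp add: word_eq.refl)

lemmas weq_side = weq_side_aux[OF weq_snow]

text \<open>Both sides obey the recursion \<open>2 * n + 4\<close>, the right one by
  \<open>f_mult_L\<close>. So \<open>snow k\<close> attains the minimal cost of its power of
  \<open>a\<close>.\<close>

lemma length_snow: "length (snow k) = f (int L ^ k)"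
proof (induction k)
  case 0
  show ?case using f_le_abs[of 1] f_one_le[of 1] by simp
next
  case (Suc k)
  then show ?case
    using f_mult_L[of "int L ^ k"] L_ge by (simp add: g_def)
qed

lemma length_snow_Suc: "length (snow (Suc k)) = 2 * length (snow k) + 4"
  by simp

text \<open>The prefix of length \<open>l\<close> of \<open>snow k\<close>, with all negative letters eliminated.\<close>

fun prefix :: "nat \<Rightarrow> nat \<Rightarrow> snowflake_gen word" where
  "prefix 0 l = (if l = 0 then [] else [pos Ga])"
| "prefix (Suc k) l =
    (if l = 0 then []
     else if l \<le> length (snow k) + 1 then pos Gs # prefix k (l - 1)
     else if l = length (snow k) + 2 then replicate (L ^ k) (pos Gx)
     else if l \<le> 2 * length (snow k) + 3
       then replicate (L ^ k) (pos Gx) @ pos Gt # prefix k (l - (length (snow k) + 3))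
     else replicate (L ^ Suc k) (pos Ga))"

lemma positive_replicate [simp]: "positive (replicate n (pos z))"
  by (auto simp: positive_def)

lemma positive_prefix [simp]: "positive (prefix k l)"
  by (induction k arbitrary: l) auto

declare prefix.simps(2) [simp del] snow.simps(2) [simp del]

lemma prefix_simps:
  assumes "n = length (snow k)"
  shows "prefix (Suc k) 0 = []"
    and "j \<le> n \<Longrightarrow> prefix (Suc k) (j + 1) = pos Gs # prefix k j"
    and "prefix (Suc k) (n + 2) = replicate (L ^ k) (pos Gx)"
    and "j \<le> n \<Longrightarrow> prefix (Suc k) (n + 3 + j) = replicate (L ^ k) (pos Gx) @ pos Gt # prefix k j"
    and "prefix (Suc k) (2 * n + 4) = replicate (L ^ Suc k) (pos Ga)"
  using assms by (auto simp: prefix.simps)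

lemma prefix_position_cases:
  assumes "l \<le> 2 * n + (4 :: nat)"
  obtains "l = 0" | j where "l = j + 1" "j \<le> n" | "l = n + 2" | j where "l = n + 3 + j" "j \<le> n"
    | "l = 2 * n + 4"
proof -
  consider "l = 0" | "1 \<le> l" "l \<le> n + 1" | "l = n + 2" | "n + 3 \<le> l" "l \<le> 2 * n + 3" | "l = 2 * n + 4"
    using assms by linarith
  then show ?thesis
    using that(1) that(2)[of "l - 1"] that(3) that(4)[of "l - (n + 3)"] that(5) by cases auto
qed

lemma weq_prefix: "l \<le> length (snow k) \<Longrightarrow> weq (take l (snow k)) (prefix k l)"
proof (induction k arbitrary: l)
  case 0
  then show ?case by (cases l) (auto intro: word_eq.refl)
next
  case (Suc k)
  define n where "n = length (snow k)"
  have "l \<le> 2 * n + 4" using Suc.prems by (simp add: length_snow_Suc n_def)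
  then show ?case
  proof (cases rule: prefix_position_cases)
    case 1
    then show ?thesis by (simp add: prefix_simps[OF n_def] word_eq.refl)
  next
    case (2 j)
    then have "take l (snow (Suc k)) = [pos Gs] @ take j (snow k)"
      by (simp add: snow.simps n_def)
    then show ?thesis
      using 2 Suc.IH[of j] weq_append[OF word_eq.refl, of "take j (snow k)" "prefix k j" "[pos Gs]"]
      by (simp add: prefix_simps(2)[OF n_def, simplified] n_def)
  next
    case 3
    then have "take l (snow (Suc k)) = side Gs k"
      by (simp add: snow.simps n_def side_def)
    then show ?thesis
      using weq_side[of Gs k] 3 prefix_simps(3)[OF n_def] by simp
  next
    case (4 j)
    have "snow (Suc k) = (side Gs k @ [pos Gt]) @ (snow k @ [neg Gt])"
      by (simp add: snow.simps side_def)
    then have "take l (snow (Suc k)) = side Gs k @ [pos Gt] @ take j (snow k)"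
      unfolding \<open>snow (Suc k) = _\<close> take_append using 4 by (simp add: n_def side_def)
    moreover have "prefix (Suc k) l = replicate (L ^ k) (pos Gx) @ pos Gt # prefix k j"
      using 4 prefix_simps(4)[OF n_def, of j] by simp
    ultimately show ?thesis
      using 4 Suc.IH[of j] weq_append[OF weq_side[of Gs k] weq_append[OF word_eq.refl],
          of "take j (snow k)" "prefix k j" "[pos Gt]"]
      by (simp add: n_def)
  next
    case 5
    then have "take l (snow (Suc k)) = snow (Suc k)" by (simp add: length_snow_Suc n_def)
    then show ?thesis
      using weq_snow[of "Suc k"] 5 prefix_simps(5)[OF n_def] by simp
  qed
qed

text \<open>The paths cross \<open>s\<close> and \<open>t\<close> at \<open>u\<close> and
  \<open>v\<close>, and \<open>r\<close> and \<open>q\<close> count letters \<open>y\<close> on the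
  way to \<open>a^i\<close>. If \<open>r = q\<close>, both are compared at \<open>a^r\<close>, and
  \<open>g m \<le> g r + g (r - m)\<close> gives the rest. Otherwise replacing \<open>q\<close> by
  \<open>r\<close> changes two values of \<open>g\<close>, and \<open>L_abs\<close> pays for
  it.\<close>

lemma D_prefix_middle:
  assumes "positive p" "positive p'" and m: "m \<noteq> 0"
    and c: "\<And>k. c \<le> D p (vec Ga k) + D p' (vec Ga k)"
  shows "c + 2 + g (int m) \<le> D (pos Gs # p) (vec Ga i) + D (replicate m (pos Gx) @ pos Gt # p') (vec Ga i)"
proof -
  obtain u where u: "D (pos Gs # p) (vec Ga i) = D p (vec Ga u) + 1 + \<nu> (vec Ga i - vec Gx u)"
    using D_pos_attained[OF assms(1), of Gs "vec Ga i"] by auto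
  obtain v where v: "D (pos Gt # p') (vec Ga i - vec Gx m)
      = D p' (vec Ga v) + 1 + \<nu> (vec Ga i - vec Gx m - vec Gy v)"
    using D_pos_attained[OF assms(2), of Gt "vec Ga i - vec Gx m"] by auto
  obtain r where r: "\<nu> (i, - u) = nat \<bar>i - int L * r\<bar> + g (- u + r) + g r" by (rule \<nu>_attained)
  obtain q' where q': "\<nu> (i - int L * v, v - m) = nat \<bar>i - int L * v - int L * q'\<bar> + g (v - m + q') + g q'"
    by (rule \<nu>_attained)
  \<comment> \<open>The shift by \<open>v\<close> makes \<open>q\<close> comparable with
    \<open>r\<close>: now \<open>i\<close> is measured against \<open>L * q\<close> as it was
    against \<open>L * r\<close>.\<close>
  define q where "q = v + q'"
  have q: "\<nu> (i - int L * v, v - m) = nat \<bar>i - int L * q\<bar> + g (q - m) + g (q - v)"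
    using q' by (simp add: q_def algebra_simps)
  have "f (r - u) \<le> g (r - u)" "f (r - v) \<le> g (r - v)" by (rule f_le_g)+
  moreover have "D p (vec Ga r) \<le> D p (vec Ga u) + f (r - u)"
      "D p' (vec Ga r) \<le> D p' (vec Ga v) + f (r - v)"
    using D_add[of p "vec Ga u" "vec Ga (r - u)"] D_add[of p' "vec Ga v" "vec Ga (r - v)"]
      \<nu>_a[of "r - u"] \<nu>_a[of "r - v"]
    by (simp_all flip: vec_add del: vec.simps)
  moreover have "g (r - m) \<le> g (q - m) + 3 * nat \<bar>r - q\<bar>" "g (r - v) \<le> g (q - v) + 3 * nat \<bar>r - q\<bar>"
    using g_lipschitz[of "r - m" "q - m"] g_lipschitz[of "r - v" "q - v"] by simp_all
  moreover have "g m \<le> g r + g (r - m)" by (rule g_le_diff)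
  moreover have "D (replicate m (pos Gx) @ pos Gt # p') (vec Ga i) = D (pos Gt # p') (vec Ga i - vec Gx m)"
    using D_replicate[of Gx m True "pos Gt # p'" "vec Ga i"] by (simp add: sgn_of_def)
  moreover have "\<nu> (vec Ga i - vec Gx u) = \<nu> (i, - u)"
    "\<nu> (vec Ga i - vec Gx m - vec Gy v) = \<nu> (i - int L * v, v - m)"
    by simp_all
  moreover have "g (- u + r) = g (r - u)" by simp
  ultimately show ?thesis
    using u v r q L_abs[of r q i] c[of r] by linarith
qed

lemma D_prefix:
  "l \<le> length (snow k) \<Longrightarrow>
    length (snow k) \<le> D (prefix k l) (vec Ga i) + D (prefix k (length (snow k) - l)) (vec Ga i)"
proof (induction k arbitrary: l i)
  case 0
  have "D [pos Ga] (i, 0) = f (i - 1)"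
    using D_H[of Ga True "[]" "(i, 0)"] \<nu>_a[of "i - 1"] by (simp add: sgn_of_def)
  moreover have "f i + f (i - 1) \<ge> 1"
    using f_one_le[of i] f_one_le[of "i - 1"] by (cases "i = 0") auto
  ultimately show ?case
    using 0 \<nu>_a[of i] by (cases "l = 0") auto
next
  case (Suc k)
  define n where "n = length (snow k)"
  note ps = prefix_simps[OF n_def]
  have len: "length (snow (Suc k)) = 2 * n + 4" by (simp add: length_snow_Suc n_def)
  have m: "g (int (L ^ k)) = n + 2" "L ^ k \<noteq> 0"
    using L_ge by (simp_all add: g_def n_def length_snow)
  \<comment> \<open>\<open>l\<close> and \<open>2 * n + 4 - l\<close> play symmetric roles, so half
    of the positions suffice; the partner of a position inside the first side lies inside the
    second.\<close>
  have *: "2 * n + 4 \<le> D (prefix (Suc k) l) (vec Ga i) + D (prefix (Suc k) (2 * n + 4 - l)) (vec Ga i)"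
    if "l \<le> n + 2" for l
  proof -
    have "l \<le> 2 * n + 4" using that by simp
    then show ?thesis
    proof (cases rule: prefix_position_cases)
      case 1
      \<comment> \<open>The empty and the whole word: a triangle inequality through
        \<open>a^i\<close>.\<close>
      have "D (replicate (L ^ Suc k) (pos Ga)) (vec Ga i) = f (i - int L ^ Suc k)"
        using D_replicate[of Ga "L ^ Suc k" True "[]" "vec Ga i"] \<nu>_a[of "i - int L ^ Suc k"]
        by (simp add: sgn_of_def)
      moreover have "f (int L ^ Suc k) = 2 * n + 4"
        using length_snow[of "Suc k"] len by simp
      moreover have "f (int L ^ Suc k) \<le> f i + f (i - int L ^ Suc k)"
        using f_add[of i "int L ^ Suc k - i"] f_minus[of "i - int L ^ Suc k"] by simp
      ultimately show ?thesis
        using 1 by (simp add: ps \<nu>_a del: vec.simps)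
    next
      case (2 j)
      then have "2 * n + 4 - l = n + 3 + (n - j)" by simp
      moreover have "n + 2 + g (int (L ^ k)) \<le> D (pos Gs # prefix k j) (vec Ga i)
          + D (replicate (L ^ k) (pos Gx) @ pos Gt # prefix k (n - j)) (vec Ga i)"
        by (rule D_prefix_middle) (use Suc.IH[of j] 2 m in \<open>simp_all add: n_def\<close>)
      ultimately show ?thesis
        using 2 m ps(2)[of j] ps(4)[of "n - j"] by simp
    next
      case 3
      \<comment> \<open>Both prefixes are \<open>x^(L^k)\<close>, and each alone is at distance at
        least half the total from \<open>a^i\<close>.\<close>
      obtain r where r: "\<nu> (i, - int (L ^ k)) = nat \<bar>i - int L * r\<bar> + g (- int (L ^ k) + r) + g r"
        by (rule \<nu>_attained)
      have "D (replicate (L ^ k) (pos Gx)) (vec Ga i) = \<nu> (i, - int (L ^ k))"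
        using D_replicate[of Gx "L ^ k" True "[]" "vec Ga i"] by (simp add: sgn_of_def)
      moreover have "n + 2 \<le> \<nu> (i, - int (L ^ k))"
        using r g_le_diff[of "int (L ^ k)" r] m by simp
      moreover have "2 * n + 4 - l = n + 2" using 3 by simp
      ultimately show ?thesis using 3 ps(3) by simp
    qed (use that in auto)
  qed
  show ?case
  proof (cases "l \<le> n + 2")
    case True
    then show ?thesis using * len by simp
  next
    case False
    then have "2 * n + 4 - l \<le> n + 2" by simp
    then show ?thesis using *[of "2 * n + 4 - l"] Suc.prems len by (simp add: add.commute)
  qed
qed

text \<open>Inside a side this is \<open>\<Phi>_antipode\<close> with \<open>D_prefix\<close>. At
  the ends of the side the word becomes a product of powers of \<open>x\<close> and
  \<open>y\<close>, to which \<open>\<nu>_xy\<close> applies.\<close>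

lemma \<Phi>_side_antipode:
  assumes e: "e \<in> {Gs, Gt}" and j: "j \<le> length (snow k) + 2"
    and V: "V = side (other e) k \<or> V = inv_word (side (other e) k)"
  shows "2 * (length (snow k) + 2) \<le> \<Phi> (acts (inv_word (take j (side e k)) @ V
    @ take (length (snow k) + 2 - j) (side e k)) ([], 0))"
proof -
  define n m z z' where "n = length (snow k)" and "m = L ^ k" and "z = src (pos e)" and "z' = src (pos (other e))"
  have o: "other e \<in> {Gs, Gt}" by (simp add: other_def)
  have zz: "(z, z') = (Gx, Gy) \<or> (z, z') = (Gy, Gx)"
    using e by (auto simp: other_def z_def z'_def)
  then have zH: "z \<in> {Ga, Gx, Gy}" "z' \<in> {Ga, Gx, Gy}" by auto
  have m: "m \<noteq> 0" "g (int m) = n + 2"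
    using L_ge by (simp_all add: g_def n_def m_def length_snow)
  obtain b where b: "weq V (replicate m (z', b))"
    using V weq_side[OF o, of k] weq_inv[OF weq_side[OF o, of k]] by (auto simp: m_def z'_def)
  have acts: "acts (inv_word u @ V @ v) ([], 0) = acts (inv_word u' @ replicate m (z', b) @ v') ([], 0)"
    if "weq u u'" "weq v v'" for u u' v v'
    by (rule acts_word_eq) (use that b in \<open>simp_all add: weq_append weq_inv\<close>)
  have side: "weq (side e k) (replicate m (pos z))"
    using weq_side[OF e, of k] by (simp add: m_def z_def)
  have full: "take (n + 2) (side e k) = side e k" by (simp add: side_def n_def)
  have sg: "g (sgn_of c * int m) = n + 2" for c
    using m by (simp add: sgn_of_def)
  \<comment> \<open>The side begins with \<open>e\<close>, so \<open>j = i + 1\<close> leaves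
    \<open>i\<close> letters of \<open>snow k\<close>, and the complementary part has
    \<open>n - i\<close> of them.\<close>
  consider "j = 0" | i where "j = i + 1" "i \<le> n" | "j = n + 2"
    using j by (cases j) (auto simp: n_def le_Suc_eq)
  then show ?thesis
  proof cases
    case 1
    have "\<Phi> (acts (replicate m (z', b) @ replicate m (pos z)) ([], 0))
        = \<nu> (vec z' (sgn_of b * int m) + vec z (sgn_of True * int m))"
      using zH by (simp add: acts_replicate \<Phi>_def del: fold_replicate)
    moreover have "n + 2 + (n + 2) \<le> \<nu> (vec z' (sgn_of b * int m) + vec z (sgn_of True * int m))"
      using \<nu>_xy[of z z' "sgn_of True * int m" "sgn_of b * int m"] zz sg by (metis add.commute)
    ultimately show ?thesis
      using acts[OF word_eq.refl side, of "[]"] 1 full by (simp add: n_def)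
  next
    case (2 i)
    have "n + 2 + g (int m)
        \<le> \<Phi> (acts (inv_word (pos e # prefix k i) @ replicate m (z', b) @ pos e # prefix k (n - i)) ([], 0))"
      unfolding z'_def using e m(1) D_prefix[of i k] 2 by (intro \<Phi>_antipode) (auto simp: n_def)
    moreover have "weq (take j (side e k)) (pos e # prefix k i)"
      using 2 weq_append[OF word_eq.refl weq_prefix, of i k "[pos e]"] by (simp add: side_def n_def)
    moreover have "n + 2 - j = (n - i) + 1" using 2 by simp
    then have "weq (take (n + 2 - j) (side e k)) (pos e # prefix k (n - i))"
      using 2 weq_append[OF word_eq.refl weq_prefix, of "n - i" k "[pos e]"] by (simp add: side_def n_def)
    ultimately show ?thesis using acts m by (simp add: n_def)
  next
    case 3
    have "\<Phi> (acts (replicate m (neg z) @ replicate m (z', b)) ([], 0))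
        = \<nu> (vec z (sgn_of False * int m) + vec z' (sgn_of b * int m))"
      using zH by (simp add: acts_replicate \<Phi>_def del: fold_replicate)
    moreover have "n + 2 + (n + 2) \<le> \<nu> (vec z (sgn_of False * int m) + vec z' (sgn_of b * int m))"
      using \<nu>_xy[of z z' "sgn_of False * int m" "sgn_of b * int m"] zz sg by metis
    ultimately show ?thesis
      using acts[OF side word_eq.refl, of "[]"] 3 full by (simp add: n_def)
  qed
qed

section \<open>The commutator loop and its antipodal vertices\<close>

definition loop :: "nat \<Rightarrow> snowflake_gen word" where
  "loop k = side Gs k @ side Gt k @ inv_word (side Gs k) @ inv_word (side Gt k)"

lemma weq_sides_commute: "weq (side Gs k @ side Gt k) (side Gt k @ side Gs k)"
proof -
  have "weq (side Gs k @ side Gt k) (replicate (L ^ k) (pos Gx) @ replicate (L ^ k) (pos Gy))"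
    using weq_side[of Gs k] weq_side[of Gt k] by (intro weq_append) simp_all
  also have "weq \<dots> (replicate (L ^ k) (pos Gy) @ replicate (L ^ k) (pos Gx))"
    by (rule weq_commute_power[OF weq_xy])
  also have "weq \<dots> (side Gt k @ side Gs k)"
    using weq_side[of Gs k] weq_side[of Gt k] by (intro weq_append) (simp_all add: word_eq.sym)
  finally show ?thesis .
qed

lemma weq_loop: "weq (loop k) []"
proof -
  let ?u = "side Gs k" and ?v = "side Gt k"
  have "weq ((?u @ ?v) @ inv_word ?u @ inv_word ?v) ((?v @ ?u) @ inv_word ?u @ inv_word ?v)"
    by (rule weq_append[OF weq_sides_commute word_eq.refl])
  also have "weq \<dots> (?v @ inv_word ?v)"
    using weq_cancel_mid[OF weq_inv_right[of ?u], of ?v "inv_word ?v"] by simp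
  also have "weq \<dots> []" by (rule weq_inv_right)
  finally show ?thesis by (simp add: loop_def)
qed

lemma length_inv_word [simp]: "length (inv_word w) = length w"
  by (simp add: inv_word_def)

lemma length_side [simp]: "length (side e k) = length (snow k) + 2"
  by (simp add: side_def)

lemma length_loop: "length (loop k) = 4 * (length (snow k) + 2)"
  by (simp add: loop_def)

lemma take_inv_word: "take i (inv_word w) = inv_word (drop (length w - i) w)"
  by (simp add: inv_word_def take_rev drop_map)

lemma weq_append_take_inv: "weq (w @ take i (inv_word w)) (take (length w - i) w)"
  using weq_cancel_mid[OF weq_inv_right, of "take (length w - i) w" "drop (length w - i) w" "[]"]
  by (simp add: take_inv_word flip: append_assoc)

text \<open>As the two sides commute, vertices on the third and fourth sides are also reached by
  starting with \<open>side Gt\<close>. These words bring antipodal pairs into the form of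
  \<open>\<Phi>_side_antipode\<close>.\<close>

lemma weq_take_loop:
  fixes k defines "h \<equiv> length (snow k) + 2"
  assumes "j \<le> h"
  shows "take j (loop k) = take j (side Gs k)"
    and "take (h + j) (loop k) = side Gs k @ take j (side Gt k)"
    and "weq (take (2 * h + j) (loop k)) (side Gt k @ take (h - j) (side Gs k))"
    and "weq (take (3 * h + j) (loop k)) (take (h - j) (side Gt k))"
proof -
  let ?u = "side Gs k" and ?v = "side Gt k"
  show "take j (loop k) = take j ?u" "take (h + j) (loop k) = ?u @ take j ?v"
    using assms by (auto simp: loop_def)
  have "take (2 * h + j) (loop k) = (?u @ ?v) @ take j (inv_word ?u)"
    using assms by (simp add: loop_def)
  also have "weq \<dots> ((?v @ ?u) @ take j (inv_word ?u))"
    by (rule weq_append[OF weq_sides_commute word_eq.refl])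
  also have "weq \<dots> (?v @ take (h - j) ?u)"
    using weq_append[OF word_eq.refl weq_append_take_inv, of ?v ?u j] by (simp add: h_def)
  finally show "weq (take (2 * h + j) (loop k)) (?v @ take (h - j) ?u)" .
  have "take (3 * h + j) (loop k) = (?u @ ?v) @ inv_word ?u @ take j (inv_word ?v)"
    using assms by (simp add: loop_def)
  also have "weq \<dots> ((?v @ ?u) @ inv_word ?u @ take j (inv_word ?v))"
    by (rule weq_append[OF weq_sides_commute word_eq.refl])
  also have "weq \<dots> (?v @ take j (inv_word ?v))"
    using weq_cancel_mid[OF weq_inv_right[of ?u], of ?v "take j (inv_word ?v)"] by simp
  also have "weq \<dots> (take (h - j) ?v)"
    using weq_append_take_inv[of ?v j] by (simp add: h_def)
  finally show "weq (take (3 * h + j) (loop k)) (take (h - j) ?v)" .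
qed

text \<open>Antipodal vertices lie on opposite sides at complementary positions; \<open>e\<close> is
  the letter of their sides and \<open>V\<close> the side joining them, possibly reversed.\<close>

lemma \<Phi>_loop_antipode:
  fixes k defines "h \<equiv> length (snow k) + 2"
  assumes "i < 4 * h"
  shows "2 * h \<le> \<Phi> (acts (inv_word (take i (loop k)) @ take ((i + 2 * h) mod (4 * h)) (loop k)) ([], 0))"
proof -
  let ?u = "side Gs k" and ?v = "side Gt k"
  have o: "other Gs = Gt" "other Gt = Gs" by (simp_all add: other_def)
  have key: "2 * h \<le> \<Phi> (acts (inv_word p @ q) ([], 0))"
    if "weq (inv_word p @ q) (inv_word (take j (side e k)) @ V @ take (h - j) (side e k))"
      "e \<in> {Gs, Gt}" "j \<le> h" "V = side (other e) k \<or> V = inv_word (side (other e) k)" for p q j e V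
    using \<Phi>_side_antipode[OF that(2) _ that(4)] that(3) acts_word_eq[OF that(1), of "([], 0)"]
    by (simp add: h_def)
  consider j where "i = j" "j \<le> h" | j where "i = h + j" "j < h" | j where "i = 2 * h + j" "j < h"
    | j where "i = 3 * h + j" "j < h"
  proof -
    consider "i < h" | "h \<le> i" "i < 2 * h" | "2 * h \<le> i" "i < 3 * h" | "3 * h \<le> i"
      by linarith
    then show ?thesis
      using that(1)[of i] that(2)[of "i - h"] that(3)[of "i - 2 * h"] that(4)[of "i - 3 * h"] assms(2)
      by cases auto
  qed
  then show ?thesis
  proof cases
    case (1 j)
    have "(i + 2 * h) mod (4 * h) = 2 * h + j" using 1 by (simp add: h_def)
    moreover have "weq (inv_word (take i (loop k)) @ take (2 * h + j) (loop k))
        (inv_word (take j ?u) @ ?v @ take (h - j) ?u)"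
      using 1 weq_take_loop(1,3)[of j k, folded h_def] by (intro weq_append weq_inv) (simp_all add: word_eq.refl)
    ultimately show ?thesis using key[of _ _ j Gs ?v] 1 o by simp
  next
    case (2 j)
    have "(i + 2 * h) mod (4 * h) = 3 * h + j" using 2 by simp
    moreover have "weq (inv_word (take i (loop k)) @ take (3 * h + j) (loop k))
        (inv_word (?u @ take j ?v) @ take (h - j) ?v)"
      using 2 weq_take_loop(2,4)[of j k, folded h_def] by (intro weq_append weq_inv) (simp_all add: word_eq.refl)
    ultimately show ?thesis using key[of _ _ j Gt "inv_word ?u"] 2 o by simp
  next
    case (3 j)
    have "(i + 2 * h) mod (4 * h) = j" using 3 by (simp add: mod_if)
    moreover have "weq (inv_word (take i (loop k)) @ take j (loop k))
        (inv_word (?v @ take (h - j) ?u) @ take j ?u)"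
      using 3 weq_take_loop(1,3)[of j k, folded h_def] by (intro weq_append weq_inv) (simp_all add: word_eq.refl)
    ultimately show ?thesis using key[of _ _ "h - j" Gs "inv_word ?v"] 3 o by simp
  next
    case (4 j)
    have "(i + 2 * h) mod (4 * h) = h + j" using 4 by (simp add: mod_if)
    moreover have "weq (inv_word (take i (loop k)) @ take (h + j) (loop k))
        (inv_word (take (h - j) ?v) @ ?u @ take j ?v)"
      using 4 weq_take_loop(2,4)[of j k, folded h_def] by (intro weq_append weq_inv) (simp_all add: word_eq.refl)
    ultimately show ?thesis using key[of _ _ "h - j" Gt ?u] 4 o by simp
  qed
qed

lemma fst_loop: "l \<in> set (loop k) \<Longrightarrow> fst l \<in> {Ga, Gs, Gt}"
proof -
  have "fst ` set (snow k) \<subseteq> {Ga, Gs, Gt}"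
    by (induction k) (auto simp: snow.simps)
  then have "fst ` set (loop k) \<subseteq> {Ga, Gs, Gt}"
    by (simp add: loop_def side_def inv_word_def image_Un image_image)
  then show "l \<in> set (loop k) \<Longrightarrow> fst l \<in> {Ga, Gs, Gt}" by blast
qed

lemma length_snow_ge: "k \<le> length (snow k)"
  by (induction k) (auto simp: length_snow_Suc)

lemma \<Phi>_word_dist:
  "\<bar>real (\<Phi> (acts (w @ u) ([], 0))) - real (\<Phi> (acts (w @ u @ [(z, b)]) ([], 0)))\<bar> \<le> snowflake_len L z"
proof -
  define st where "st = acts (w @ u) ([], 0)"
  have "reduced (fst st)" unfolding st_def by (rule reduced_acts) simp
  then have "act (inv_letter (z, b)) (act (z, b) st) = st" by (rule act_inv)
  then have "real (\<Phi> st) \<le> real (\<Phi> (act (z, b) st)) + snowflake_len L z"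
    using \<Phi>_act[of "inv_letter (z, b)" "act (z, b) st"] by simp
  moreover have "real (\<Phi> (act (z, b) st)) \<le> real (\<Phi> st) + snowflake_len L z"
    using \<Phi>_act[of "(z, b)" st] by simp
  moreover have "acts (w @ u @ [(z, b)]) ([], 0) = act (z, b) st" by (simp add: st_def)
  ultimately show ?thesis by (simp add: st_def)
qed

section \<open>The loop as a cycle in the Cayley graph\<close>

abbreviation cls :: "snowflake_gen word \<Rightarrow> snowflake_gen word set" where
  "cls \<equiv> word_class (snowflake_relations L)"

text \<open>The potential for distances from the vertex of \<open>w\<close>, which left translation
  moves to the identity. By \<open>acts_word_eq\<close> the chosen representative does not
  matter.\<close>

definition \<delta> :: "snowflake_gen word \<Rightarrow> snowflake_gen word set \<Rightarrow> real" where
  "\<delta> w U = real (\<Phi> (acts (inv_word w @ (SOME u. cls u = U)) ([], 0)))"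

lemma \<delta>_cls: "\<delta> w (cls u) = real (\<Phi> (acts (inv_word w @ u) ([], 0)))"
proof -
  have "cls (SOME v. cls v = cls u) = cls u" by (rule someI) simp
  then have "weq (inv_word w @ (SOME v. cls v = cls u)) (inv_word w @ u)"
    by (intro weq_append word_eq.refl) (simp add: word_class_eq_iff)
  from acts_word_eq[OF this, of "([], 0)"] show ?thesis by (simp add: \<delta>_def)
qed

lemma snowflake_graph_simps:
  "verts (snowflake_graph L) = range cls"
  "arcs (snowflake_graph L) = range cls \<times> UNIV"
  "tail (snowflake_graph L) (U, z) = U"
  "head (snowflake_graph L) (cls u, z) = cls (u @ [pos z])"
  "len (snowflake_graph L) (U, z) = snowflake_len L z"
  by (simp_all add: snowflake_graph_def cayley_graph_def snowflake_group_def
      carrier_presented_group mult_word_class)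

text \<open>A negative letter runs against its Cayley edge, whose tail is therefore the later vertex
  \<open>Suc i\<close>.\<close>

definition loop_map where
  "loop_map k =
     \<lparr>vmap = (\<lambda>i. cls (take i (loop k))),
      emap = (\<lambda>i. (cls (take (if snd (loop k ! i) then i else Suc i) (loop k)), fst (loop k ! i))),
      keeps = (\<lambda>i. snd (loop k ! i))\<rparr>"

lemma cls_take_mod:
  assumes "i < length (loop k)"
  shows "cls (take (Suc i mod length (loop k)) (loop k)) = cls (take (Suc i) (loop k))"
proof (cases "Suc i = length (loop k)")
  case True
  then show ?thesis using word_eq.sym[OF weq_loop[of k]] by (simp add: word_class_eq_iff)
qed (use assms in simp)

lemma is_cycle_loop: "is_cycle (snowflake_graph L) (length (loop k), loop_map k)"
proof -
  have "cls (take (Suc i) (loop k) @ [pos z]) = cls (take i (loop k))"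
    if "i < length (loop k)" "loop k ! i = neg z" for i z
    using that word_eq.cancel[of "snowflake_relations L" "take i (loop k)" z False "[]"]
    by (simp add: take_Suc_conv_app_nth word_class_eq_iff)
  moreover have "cls (take i (loop k) @ [pos z]) = cls (take (Suc i) (loop k))"
    if "i < length (loop k)" "loop k ! i = pos z" for i z
    using that by (simp add: take_Suc_conv_app_nth)
  ultimately show ?thesis
    using length_loop[of k] cls_take_mod[of _ k]
    by (auto simp: is_cycle_def combinatorial_map_def cycle_domain_def circle_def loop_map_def
        snowflake_graph_simps prod_eq_iff split: prod.splits)
qed

lemma len_loop: "i < length (loop k) \<Longrightarrow> len (snowflake_graph L) (emap (loop_map k) i) = 1"
  using fst_loop[OF nth_mem, of i k] by (auto simp: loop_map_def snowflake_graph_simps)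

lemma isometric_loop: "isometric_cycle (snowflake_graph L) (length (loop k), loop_map k)"
proof -
  define h where "h = length (snow k) + 2"
  have n: "length (loop k) = 2 * (2 * h)" by (simp add: length_loop h_def)
  have "isometric_cycle (snowflake_graph L) (2 * (2 * h), loop_map k)"
  proof (rule isometric_cycle_if_antipodal[where \<delta> = "\<lambda>i. \<delta> (take i (loop k))"])
    show "is_cycle (snowflake_graph L) (2 * (2 * h), loop_map k)"
      using is_cycle_loop[of k] by (simp only: n)
    show "2 \<le> 2 * h" by (simp add: h_def)
    show "len (snowflake_graph L) (emap (loop_map k) i) = 1" if "i < 2 * (2 * h)" for i
      using len_loop[of i k] that by (simp only: n)
    show "\<forall>e\<in>arcs (snowflake_graph L).
        tail (snowflake_graph L) e \<in> verts (snowflake_graph L) \<and> head (snowflake_graph L) e \<in> verts (snowflake_graph L)"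
      by (auto simp: snowflake_graph_simps)
    show "\<bar>\<delta> (take i (loop k)) (tail (snowflake_graph L) e) - \<delta> (take i (loop k)) (head (snowflake_graph L) e)\<bar>
        \<le> len (snowflake_graph L) e" if "e \<in> arcs (snowflake_graph L)" for i e
      using that \<Phi>_word_dist[of "inv_word (take i (loop k))" _ _ True]
      by (auto simp: snowflake_graph_simps \<delta>_cls simp del: fold_append)
    show "\<delta> (take i (loop k)) (vmap (loop_map k) i) = 0" for i
      using acts_word_eq[OF weq_inv_left[of "take i (loop k)"], of "([], 0)"]
      by (simp add: loop_map_def \<delta>_cls \<Phi>_def)
    show "real (2 * h) \<le> \<delta> (take i (loop k)) (vmap (loop_map k) ((i + 2 * h) mod (2 * (2 * h))))"
      if "i < 2 * (2 * h)" for i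
      using \<Phi>_loop_antipode[of i k] that by (simp add: loop_map_def \<delta>_cls h_def del: fold_append)
  qed
  then show ?thesis by (simp only: n)
qed

lemma cycle_length_loop: "cycle_length (snowflake_graph L) (length (loop k), loop_map k) = real (length (loop k))"
  using len_loop[of _ k] by (simp add: cycle_length_def cycle_domain_def circle_def)

end

theorem corollary4p0p2:
  fixes L :: nat
  assumes "even L" and "L \<ge> 6"
  shows "\<not> shortcut (snowflake_graph L) \<and> \<not> strongly_shortcut (snowflake_graph L)"
proof -
  interpret snowflake L by unfold_locales (rule assms(2))
  let ?\<Gamma> = "snowflake_graph L"
  define c where "c k = (length (loop k), loop_map k)" for k
  have iso: "isometric_cycle ?\<Gamma> (c k)" for k
    unfolding c_def by (rule isometric_loop)
  have bilip: "bilipschitz_cycle ?\<Gamma> K (c k)" if "K > 1" for k K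
  proof -
    \<comment> \<open>Nonnegative distances only shrink under the factor
      \<open>1 / K\<close>.\<close>
    have "0 \<le> path_dist (cycle_domain ?\<Gamma> (c k)) p q"
      if "p \<in> points (cycle_domain ?\<Gamma> (c k))" "q \<in> points (cycle_domain ?\<Gamma> (c k))" for p q
      using that unfolding cycle_domain_def
      by (intro path_dist_circle_nonneg) (use len_loop in \<open>auto simp: c_def length_loop\<close>)
    then have "1 / K * path_dist (cycle_domain ?\<Gamma> (c k)) p q \<le> path_dist (cycle_domain ?\<Gamma> (c k)) p q"
      if "p \<in> points (cycle_domain ?\<Gamma> (c k))" "q \<in> points (cycle_domain ?\<Gamma> (c k))" for p q
      using that \<open>K > 1\<close> by (intro mult_left_le_one_le) auto
    then show ?thesis
      using iso[of k] by (auto simp: isometric_cycle_def bilipschitz_cycle_def)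
  qed
  have long: "\<exists>k. B < cycle_length ?\<Gamma> (c k)" for B
  proof -
    obtain k where "B < real k" using reals_Archimedean2 by blast
    then show ?thesis
      using length_snow_ge[of k] unfolding c_def cycle_length_loop
      by (intro exI[of _ k]) (simp add: length_loop)
  qed
  show ?thesis
    using iso bilip long unfolding shortcut_def strongly_shortcut_def by (metis not_le)
qed

end
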